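(* Let $a\in(0,1)$ and $0<z<2$ be fixed. Then, to leading order as $n\to\infty$, $$P_n^S\bigl(z;2\lfloor an/2\rfloor\bigr)\sim-\frac{5z}{2n^{3/2}(2-z)^2\sqrt{\pi a^3(1-a)^3}},$$ where $\sim$ means that the ratio of the two sides tends to $1$.
   Context: For integers $n,j\ge 0$ and $z>0$, let $C_n(z;j)$ be the partition function of pairs of lattice paths in $\mathbb{Z}^2$ with steps $(1,1)$ and $(1,-1)$ such that: the bottom path goes from $(0,0)$ to $(2n,0)$ and never goes below $Y=0$ (a Dyck path); the top path goes from $(0,2)$ to $(2n,2j+2)$; and the two paths have no vertex in common. Each pair is weighted by $z^{v}$, where $v$ is the number of vertices of the bottom path on $Y=0$ other than the origin. For example $C_0(z;0)=1$, $C_1(z;0)=C_1(z;1)=z$, $C_2(z;0)=z+2z^2$. The case $j=0$ describes (after removal of the two end vertices) staircase polygons grafted at both ends to the adsorbing line. For $0<q<n$, the partition function of those pairs counted by $C_n(z;0)$ whose bottom path passes through the vertex at horizontal distance $2q$ from the origin on $Y=0$ (so $q$, like $n$, is measured in half-lengths) is $$Z_n^*(z;q)=\sum_{j=0}^nC_q(z;j)\,C_{n-q}(z;j),$$ and the pressure is $$P_n^S(z;q)=\log\left(1-\frac{Z_n^*(z;q)}{C_n(z;0)}\right).$$ *)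

theory Defs
  imports Complex_Main "HOL-Library.Product_Plus" "HOL-Library.Landau_Symbols"
begin

type_synonym vertex = "int \<times> int"

definition lattice_step :: "vertex \<Rightarrow> vertex \<Rightarrow> bool" where
  "lattice_step u v \<longleftrightarrow> v - u \<in> {(1, 1), (1, -1)}"

text \<open>A path is represented by the list of its vertices.\<close>

definition paths :: "vertex \<Rightarrow> vertex \<Rightarrow> vertex list set" where
  "paths u v = {p. p \<noteq> [] \<and> hd p = u \<and> last p = v \<and> successively lattice_step p}"

definition path_pairs :: "nat \<Rightarrow> nat \<Rightarrow> (vertex list \<times> vertex list) set" where
  "path_pairs n j =
     {(b, t). b \<in> paths (0, 0) (2 * int n, 0) \<and> (\<forall>v\<in>set b. snd v \<ge> 0) \<and>
              t \<in> paths (0, 2) (2 * int n, 2 * int j + 2) \<and> set b \<inter> set t = {}}"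

definition contacts :: "vertex list \<Rightarrow> nat" where
  "contacts b = card {v \<in> set b. snd v = 0 \<and> v \<noteq> (0, 0)}"

definition C :: "nat \<Rightarrow> real \<Rightarrow> nat \<Rightarrow> real" where
  "C n z j = (\<Sum>(b, t)\<in>path_pairs n j. z ^ contacts b)"

text \<open>The convolution formula for \<open>Zstar\<close> is derived below as \<open>Zstar_eq_sum\<close>.\<close>

definition Zstar :: "nat \<Rightarrow> real \<Rightarrow> nat \<Rightarrow> real" where
  "Zstar n z q = (\<Sum>(b, t)\<in>{(b, t) \<in> path_pairs n 0. (2 * int q, 0) \<in> set b}. z ^ contacts b)"

definition pressure :: "nat \<Rightarrow> real \<Rightarrow> nat \<Rightarrow> real" where
  "pressure n z q = ln (1 - Zstar n z q / C n z 0)"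


lemma lattice_step_iff:
  "lattice_step u v \<longleftrightarrow> fst v = fst u + 1 \<and> (snd v = snd u + 1 \<or> snd v = snd u - 1)"
  by (cases u; cases v) (auto simp: lattice_step_def)

lemma paths_nth_step:
  assumes "p \<in> paths u v" "Suc i < length p"
  shows "lattice_step (p ! i) (p ! Suc i)"
  using assms by (auto simp: paths_def successively_conv_nth)

lemma paths_nth_0: "p \<in> paths u v \<Longrightarrow> p ! 0 = u"
  by (auto simp: paths_def hd_conv_nth)

lemma paths_nth_last: "p \<in> paths u v \<Longrightarrow> p ! (length p - 1) = v"
  by (auto simp: paths_def last_conv_nth)

lemma paths_fst_nth:
  assumes "p \<in> paths u v" "i < length p"
  shows "fst (p ! i) = fst u + int i"
  using assms(2)
proof (induction i)
  case 0
  show ?case using paths_nth_0[OF assms(1)] by simp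
next
  case (Suc i)
  show ?case using paths_nth_step[OF assms(1) Suc.prems] Suc by (auto simp: lattice_step_iff)
qed

lemma paths_length:
  assumes "p \<in> paths u v"
  shows "int (length p) = fst v - fst u + 1"
proof -
  have "length p > 0" using assms by (auto simp: paths_def)
  then have "length p - 1 < length p" "int (length p - 1) = int (length p) - 1" by linarith+
  then show ?thesis
    using paths_fst_nth[OF assms, of "length p - 1"] paths_nth_last[OF assms] by simp
qed

lemma paths_snd_nth:
  assumes "p \<in> paths u v" "i < length p"
  shows "even (snd (p ! i) - snd u - int i) \<and> \<bar>snd (p ! i) - snd u\<bar> \<le> int i"
  using assms(2)
proof (induction i)
  case 0
  show ?case using paths_nth_0[OF assms(1)] by simp
next
  case (Suc i)
  then have *: "even (snd (p ! i) - snd u - int i)" "\<bar>snd (p ! i) - snd u\<bar> \<le> int i" by auto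
  have "snd (p ! Suc i) = snd (p ! i) + 1 \<or> snd (p ! Suc i) = snd (p ! i) - 1"
    using paths_nth_step[OF assms(1) Suc.prems] by (auto simp: lattice_step_iff)
  then show ?case
  proof
    assume A: "snd (p ! Suc i) = snd (p ! i) + 1"
    have "snd (p ! Suc i) - snd u - int (Suc i) = snd (p ! i) - snd u - int i" using A by simp
    then show ?thesis using * A by auto
  next
    assume A: "snd (p ! Suc i) = snd (p ! i) - 1"
    have "snd (p ! Suc i) - snd u - int (Suc i) = snd (p ! i) - snd u - int i - 2" using A by simp
    then show ?thesis using * A by auto
  qed
qed

lemma finite_paths: "finite (paths u v)"
proof -
  define L where "L = nat (fst v - fst u + 1)"
  have "paths u v \<subseteq> {p. set p \<subseteq> {fst u..fst u + int L} \<times> {snd u - int L..snd u + int L} \<and> length p = L}"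
  proof
    fix p assume p: "p \<in> paths u v"
    have L: "length p = L" using paths_length[OF p] by (simp add: L_def)
    have "x \<in> {fst u..fst u + int L} \<times> {snd u - int L..snd u + int L}" if xp: "x \<in> set p" for x
    proof -
      obtain i where i: "i < length p" "x = p ! i" using xp by (auto simp: in_set_conv_nth)
      have "fst x = fst u + int i" "\<bar>snd x - snd u\<bar> \<le> int i"
        using paths_fst_nth[OF p i(1)] paths_snd_nth[OF p i(1)] i(2) by auto
      then show ?thesis using i(1) L by (cases x) auto
    qed
    then show "p \<in> {p. set p \<subseteq> {fst u..fst u + int L} \<times> {snd u - int L..snd u + int L} \<and> length p = L}"
      using L by blast
  qed
  then show ?thesis by (rule finite_subset) (intro finite_lists_length_eq finite_cartesian_product, auto)
qed

lemma finite_path_pairs: "finite (path_pairs n j)"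
  by (rule finite_subset[of _ "paths (0, 0) (2 * int n, 0) \<times> paths (0, 2) (2 * int n, 2 * int j + 2)"])
     (auto simp: path_pairs_def intro: finite_paths)

lemma path_pairs_length:
  assumes "(b, t) \<in> path_pairs n j"
  shows "length b = 2 * n + 1" "length t = 2 * n + 1"
  using paths_length[of b "(0, 0)" "(2 * int n, 0)"]
    paths_length[of t "(0, 2)" "(2 * int n, 2 * int j + 2)"] assms
  by (auto simp: path_pairs_def)

lemma path_pairs_above:
  assumes "(b, t) \<in> path_pairs n j" "i \<le> 2 * n"
  shows "snd (t ! i) \<ge> snd (b ! i) + 2"
  using assms(2)
proof (induction i)
  case 0
  show ?case using assms by (auto simp: path_pairs_def paths_nth_0)
next
  case (Suc i)
  have b: "b \<in> paths (0, 0) (2 * int n, 0)" and t: "t \<in> paths (0, 2) (2 * int n, 2 * int j + 2)"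
    and disj: "set b \<inter> set t = {}"
    using assms(1) by (auto simp: path_pairs_def)
  have len: "Suc i < length b" "Suc i < length t" using path_pairs_length[OF assms(1)] Suc.prems by auto
  have f: "fst (b ! Suc i) = fst (t ! Suc i)"
    using paths_fst_nth[OF b len(1)] paths_fst_nth[OF t len(2)] by simp
  have "b ! Suc i \<noteq> t ! Suc i" using disj len by (metis disjoint_iff nth_mem)
  then have ne: "snd (b ! Suc i) \<noteq> snd (t ! Suc i)" using f by (simp add: prod_eq_iff)
  have "even (snd (b ! Suc i) - 0 - int (Suc i))" "even (snd (t ! Suc i) - 2 - int (Suc i))"
    using paths_snd_nth[OF b len(1)] paths_snd_nth[OF t len(2)] by auto
  then have ev: "even (snd (t ! Suc i) - snd (b ! Suc i))" by auto
  have "lattice_step (b ! i) (b ! Suc i)" "lattice_step (t ! i) (t ! Suc i)"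
    using paths_nth_step[OF b len(1)] paths_nth_step[OF t len(2)] .
  moreover have "snd (t ! i) \<ge> snd (b ! i) + 2" using Suc by simp
  ultimately have "snd (t ! Suc i) - snd (b ! Suc i) \<ge> 0" by (auto simp: lattice_step_iff)
  then show ?case using ne ev by presburger
qed

definition reflect :: "nat \<Rightarrow> vertex \<Rightarrow> vertex" where
  "reflect n v = (2 * int n - fst v, snd v)"

definition rev_path :: "nat \<Rightarrow> vertex list \<Rightarrow> vertex list" where
  "rev_path n p = rev (map (reflect n) p)"

lemma reflect_reflect [simp]: "reflect n (reflect n v) = v"
  by (simp add: reflect_def)

lemma rev_path_rev_path [simp]: "rev_path n (rev_path n p) = p"
  by (simp add: rev_path_def rev_map comp_def)

lemma inj_reflect: "inj_on (reflect n) A"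
  by (metis inj_on_def reflect_reflect)

lemma rev_path_paths:
  assumes "p \<in> paths u v"
  shows "rev_path n p \<in> paths (reflect n v) (reflect n u)"
proof -
  have "lattice_step (reflect n y) (reflect n x) = lattice_step x y" for x y
    by (auto simp: lattice_step_iff reflect_def)
  then show ?thesis
    using assms by (auto simp: paths_def rev_path_def successively_map hd_rev last_rev hd_map last_map)
qed

lemma set_rev_path: "set (rev_path n p) = reflect n ` set p"
  by (simp add: rev_path_def)

lemma paths_append:
  assumes "p \<in> paths u v" "r \<in> paths v w"
  shows "p @ tl r \<in> paths u w"
proof -
  obtain r' where r: "r = v # r'" using assms(2) by (cases r) (auto simp: paths_def)
  show ?thesis using assms unfolding r
    by (cases r') (auto simp: paths_def successively_append_iff)
qed

lemma paths_take:
  assumes "p \<in> paths u v" "k < length p"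
  shows "take (Suc k) p \<in> paths u (p ! k)"
  using assms by (auto simp: paths_def successively_conv_nth last_conv_nth)

lemma paths_drop:
  assumes "p \<in> paths u v" "k < length p"
  shows "drop k p \<in> paths (p ! k) v"
  using assms by (auto simp: paths_def successively_conv_nth hd_drop_conv_nth)

lemma set_append_paths:
  assumes "p \<in> paths u v" "r \<in> paths v w"
  shows "set (p @ tl r) = set p \<union> set r"
proof -
  obtain r' where r: "r = v # r'" using assms(2) by (cases r) (auto simp: paths_def)
  have "v \<in> set p" using assms(1) by (auto simp: paths_def)
  then show ?thesis by (auto simp: r)
qed

lemma paths_fst_range:
  assumes "p \<in> paths u v" "x \<in> set p"
  shows "fst u \<le> fst x" "fst x \<le> fst v"
proof -
  obtain i where i: "i < length p" "x = p ! i" using assms(2) by (auto simp: in_set_conv_nth)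
  then show "fst u \<le> fst x" "fst x \<le> fst v"
    using paths_fst_nth[OF assms(1) i(1)] paths_length[OF assms(1)] by auto
qed

lemma paths_end_unique:
  assumes "p \<in> paths u v" "x \<in> set p"
  shows "fst x = fst u \<Longrightarrow> x = u" "fst x = fst v \<Longrightarrow> x = v"
proof -
  obtain i where i: "i < length p" "x = p ! i" using assms(2) by (auto simp: in_set_conv_nth)
  have *: "fst x = fst u + int i" "int (length p) = fst v - fst u + 1"
    using paths_fst_nth[OF assms(1) i(1)] paths_length[OF assms(1)] i by auto
  show "fst x = fst u \<Longrightarrow> x = u" using * i paths_nth_0[OF assms(1)] by auto
  assume "fst x = fst v"
  then have "i = length p - 1" using * i by linarith
  then show "x = v" using i paths_nth_last[OF assms(1)] by auto
qed

lemma contacts_append: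
  assumes q: "q \<le> n"
    and b1: "b1 \<in> paths (0, 0) (2 * int q, 0)"
    and b2: "b2 \<in> paths (0, 0) (2 * int (n - q), 0)"
  shows "contacts (b1 @ tl (rev_path n b2)) = contacts b1 + contacts b2"
proof -
  have r: "rev_path n b2 \<in> paths (2 * int q, 0) (2 * int n, 0)"
    using rev_path_paths[OF b2, of n] q by (simp add: reflect_def of_nat_diff)
  let ?A = "{v \<in> set b1. snd v = 0 \<and> v \<noteq> (0, 0)}"
  let ?Z = "{v \<in> set b2. snd v = 0}"
  let ?e = "(2 * int (n - q), 0) :: vertex"
  have e: "?e \<in> ?Z" using b2 last_in_set[of b2] by (auto simp: paths_def)
  have o: "(0, 0) \<in> ?Z" using b2 hd_in_set[of b2] by (auto simp: paths_def)
  have "{v \<in> set (b1 @ tl (rev_path n b2)). snd v = 0 \<and> v \<noteq> (0, 0)} = ?A \<union> reflect n ` (?Z - {?e})"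
    (is "?L = ?R")
  proof (rule set_eqI)
    fix v
    have q0: "(2 * int q, 0) \<in> set b1" using b1 last_in_set[of b1] by (auto simp: paths_def)
    have 1: "v \<in> reflect n ` (?Z - {?e}) \<longleftrightarrow> v \<in> set (rev_path n b2) \<and> snd v = 0 \<and> v \<noteq> (2 * int q, 0)"
    proof -
      have "v \<in> reflect n ` (?Z - {?e}) \<longleftrightarrow> reflect n v \<in> ?Z - {?e}"
        by (metis (no_types, lifting) image_iff reflect_reflect)
      also have "\<dots> \<longleftrightarrow> reflect n v \<in> set b2 \<and> snd v = 0 \<and> v \<noteq> (2 * int q, 0)"
        using q by (cases v) (auto simp: reflect_def of_nat_diff)
      also have "reflect n v \<in> set b2 \<longleftrightarrow> v \<in> set (rev_path n b2)"
        unfolding set_rev_path by (metis (no_types, lifting) image_iff reflect_reflect)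
      finally show ?thesis .
    qed
    have 2: "(0, 0) \<in> set (rev_path n b2) \<Longrightarrow> q = 0"
      using paths_fst_range(1)[OF r, of "(0, 0)"] by simp
    show "v \<in> ?L \<longleftrightarrow> v \<in> ?R"
      using 1 2 q0 unfolding set_append_paths[OF b1 r] by auto
  qed
  moreover have "?A \<inter> reflect n ` (?Z - {?e}) = {}"
  proof -
    have False if x: "x \<in> ?A" "y \<in> ?Z - {?e}" "x = reflect n y" for x y
    proof -
      have "fst x \<le> 2 * int q" using paths_fst_range(2)[OF b1, of x] x by simp
      moreover have "fst y \<le> 2 * int (n - q)" using paths_fst_range(2)[OF b2, of y] x by simp
      ultimately have "fst y = 2 * int (n - q)" using x q by (simp add: reflect_def of_nat_diff)
      then show False using paths_end_unique(2)[OF b2, of y] x by simp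
    qed
    then show ?thesis by blast
  qed
  ultimately have "contacts (b1 @ tl (rev_path n b2)) = card ?A + card (reflect n ` (?Z - {?e}))"
    unfolding contacts_def by (simp add: card_Un_disjoint)
  also have "card (reflect n ` (?Z - {?e})) = card (?Z - {?e})"
    by (rule card_image[OF inj_reflect])
  also have "card (?Z - {?e}) = card (?Z - {(0, 0)})"
    using e o by (simp add: card_Diff_singleton)
  also have "?Z - {(0, 0)} = {v \<in> set b2. snd v = 0 \<and> v \<noteq> (0, 0)}" by auto
  finally show ?thesis by (simp add: contacts_def)
qed

lemma join_path_pairs:
  assumes q: "q \<le> n"
    and 1: "(b1, t1) \<in> path_pairs q j" and 2: "(b2, t2) \<in> path_pairs (n - q) j"
  shows "(b1 @ tl (rev_path n b2), t1 @ tl (rev_path n t2)) \<in> path_pairs n 0"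
    and "(2 * int q, 0) \<in> set (b1 @ tl (rev_path n b2))"
proof -
  have b1: "b1 \<in> paths (0, 0) (2 * int q, 0)" "\<forall>v\<in>set b1. snd v \<ge> 0"
    and t1: "t1 \<in> paths (0, 2) (2 * int q, 2 * int j + 2)" and d1: "set b1 \<inter> set t1 = {}"
    using 1 by (auto simp: path_pairs_def)
  have b2: "b2 \<in> paths (0, 0) (2 * int (n - q), 0)" "\<forall>v\<in>set b2. snd v \<ge> 0"
    and t2: "t2 \<in> paths (0, 2) (2 * int (n - q), 2 * int j + 2)" and d2: "set b2 \<inter> set t2 = {}"
    using 2 by (auto simp: path_pairs_def)
  have rb: "rev_path n b2 \<in> paths (2 * int q, 0) (2 * int n, 0)"
    using rev_path_paths[OF b2(1), of n] q by (simp add: reflect_def of_nat_diff)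
  have rt: "rev_path n t2 \<in> paths (2 * int q, 2 * int j + 2) (2 * int n, 2)"
    using rev_path_paths[OF t2, of n] q by (simp add: reflect_def of_nat_diff)
  have drev: "set (rev_path n b2) \<inter> set (rev_path n t2) = {}"
    using d2 by (simp add: set_rev_path image_Int[OF inj_reflect, symmetric])
  have x1: "set b1 \<inter> set (rev_path n t2) = {}"
  proof -
    have False if "x \<in> set b1" "x \<in> set (rev_path n t2)" for x
    proof -
      have "fst x \<le> 2 * int q" "2 * int q \<le> fst x"
        using paths_fst_range(2)[OF b1(1) that(1)] paths_fst_range(1)[OF rt that(2)] by auto
      then have "x = (2 * int q, 0)" "x = (2 * int q, 2 * int j + 2)"
        using paths_end_unique(2)[OF b1(1) that(1)] paths_end_unique(1)[OF rt that(2)] by auto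
      then show False by simp
    qed
    then show ?thesis by blast
  qed
  have x2: "set (rev_path n b2) \<inter> set t1 = {}"
  proof -
    have False if "x \<in> set (rev_path n b2)" "x \<in> set t1" for x
    proof -
      have "fst x \<le> 2 * int q" "2 * int q \<le> fst x"
        using paths_fst_range(2)[OF t1 that(2)] paths_fst_range(1)[OF rb that(1)] by auto
      then have "x = (2 * int q, 0)" "x = (2 * int q, 2 * int j + 2)"
        using paths_end_unique(2)[OF t1 that(2)] paths_end_unique(1)[OF rb that(1)] by auto
      then show False by simp
    qed
    then show ?thesis by blast
  qed
  have nonneg: "\<forall>v\<in>set (rev_path n b2). snd v \<ge> 0"
    using b2(2) by (auto simp: set_rev_path reflect_def)
  have "set (b1 @ tl (rev_path n b2)) \<inter> set (t1 @ tl (rev_path n t2)) = {}"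
    unfolding set_append_paths[OF b1(1) rb] set_append_paths[OF t1 rt]
    using d1 drev x1 x2 by blast
  moreover have "\<forall>v\<in>set (b1 @ tl (rev_path n b2)). snd v \<ge> 0"
    unfolding set_append_paths[OF b1(1) rb] using b1(2) nonneg by blast
  ultimately show "(b1 @ tl (rev_path n b2), t1 @ tl (rev_path n t2)) \<in> path_pairs n 0"
    using paths_append[OF b1(1) rb] paths_append[OF t1 rt] by (auto simp: path_pairs_def)
  have "(2 * int q, 0) \<in> set b1" using b1(1) last_in_set[of b1] by (auto simp: paths_def)
  then show "(2 * int q, 0) \<in> set (b1 @ tl (rev_path n b2))" by simp
qed

lemma split_path_pairs:
  assumes q: "q \<le> n" and bt: "(b, t) \<in> path_pairs n 0" and pin: "(2 * int q, 0) \<in> set b"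
  obtains j where "j \<le> n" "t ! (2 * q) = (2 * int q, 2 * int j + 2)"
    "(take (Suc (2 * q)) b, take (Suc (2 * q)) t) \<in> path_pairs q j"
    "(rev_path n (drop (2 * q) b), rev_path n (drop (2 * q) t)) \<in> path_pairs (n - q) j"
proof -
  have b: "b \<in> paths (0, 0) (2 * int n, 0)" "\<forall>v\<in>set b. snd v \<ge> 0"
    and t: "t \<in> paths (0, 2) (2 * int n, 2)" and d: "set b \<inter> set t = {}"
    using bt by (auto simp: path_pairs_def)
  have len: "2 * q < length b" "2 * q < length t" using path_pairs_length[OF bt] q by auto
  have bq: "b ! (2 * q) = (2 * int q, 0)"
  proof -
    obtain i where i: "i < length b" "b ! i = (2 * int q, 0)" using pin by (auto simp: in_set_conv_nth)
    then have "int i = 2 * int q" using paths_fst_nth[OF b(1) i(1)] by simp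
    then have "i = 2 * q" by linarith
    then show ?thesis using i by simp
  qed
  define h where "h = snd (t ! (2 * q))"
  have h1: "h \<ge> 2" using path_pairs_above[OF bt, of "2 * q"] q bq by (simp add: h_def)
  have "even (h - 2 - int (2 * q))" and h3: "\<bar>h - 2\<bar> \<le> int (2 * q)"
    using paths_snd_nth[OF t len(2)] by (auto simp: h_def)
  then have h2: "even h" by simp
  define j where "j = nat (h div 2 - 1)"
  have hj: "h = 2 * int j + 2" using h1 h2 by (auto simp: j_def)
  have j: "j \<le> n" using hj h3 q by linarith
  have tq: "t ! (2 * q) = (2 * int q, 2 * int j + 2)"
    using paths_fst_nth[OF t len(2)] hj by (simp add: prod_eq_iff h_def)
  have sub: "set (take k b) \<inter> set (take k t) = {}" "set (drop k b) \<inter> set (drop k t) = {}" for k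
    using d set_take_subset[of k b] set_take_subset[of k t] set_drop_subset[of k b] set_drop_subset[of k t]
    by blast+
  have first: "(take (Suc (2 * q)) b, take (Suc (2 * q)) t) \<in> path_pairs q j"
    using paths_take[OF b(1) len(1)] paths_take[OF t len(2)] b(2) sub bq tq
    by (auto simp: path_pairs_def dest: in_set_takeD simp del: take_Suc_conv_app_nth)
  have rb: "rev_path n (drop (2 * q) b) \<in> paths (0, 0) (2 * int (n - q), 0)"
    using rev_path_paths[OF paths_drop[OF b(1) len(1)], of n] bq q
    by (simp add: reflect_def of_nat_diff)
  have rt: "rev_path n (drop (2 * q) t) \<in> paths (0, 2) (2 * int (n - q), 2 * int j + 2)"
    using rev_path_paths[OF paths_drop[OF t len(2)], of n] tq q
    by (simp add: reflect_def of_nat_diff)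
  have "set (rev_path n (drop (2 * q) b)) \<inter> set (rev_path n (drop (2 * q) t)) = {}"
    using sub(2)[of "2 * q"] by (simp add: set_rev_path image_Int[OF inj_reflect, symmetric])
  moreover have "\<forall>v\<in>set (rev_path n (drop (2 * q) b)). snd v \<ge> 0"
    using b(2) by (auto simp: set_rev_path reflect_def dest: in_set_dropD)
  ultimately have "(rev_path n (drop (2 * q) b), rev_path n (drop (2 * q) t)) \<in> path_pairs (n - q) j"
    using rb rt by (auto simp: path_pairs_def)
  with j tq first that show ?thesis by blast
qed

theorem Zstar_eq_sum:
  assumes q: "q \<le> n"
  shows "Zstar n z q = (\<Sum>j=0..n. C q z j * C (n - q) z j)"
proof -
  let ?S = "SIGMA j:{0..n}. path_pairs q j \<times> path_pairs (n - q) j"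
  let ?T = "{(b, t) \<in> path_pairs n 0. (2 * int q, 0) \<in> set b}"
  let ?join = "\<lambda>(j :: nat, (b1, t1), (b2, t2)). (b1 @ tl (rev_path n b2), t1 @ tl (rev_path n t2))"
  let ?split = "\<lambda>(b, t). (nat (snd (t ! (2 * q)) div 2 - 1),
      (take (Suc (2 * q)) b, take (Suc (2 * q)) t),
      (rev_path n (drop (2 * q) b), rev_path n (drop (2 * q) t)))"
  have "(\<Sum>j=0..n. C q z j * C (n - q) z j)
      = (\<Sum>j=0..n. \<Sum>((b1, t1), (b2, t2))\<in>path_pairs q j \<times> path_pairs (n - q) j.
           z ^ contacts b1 * z ^ contacts b2)"
    by (simp add: C_def sum_product sum.cartesian_product case_prod_unfold)
  also have "\<dots> = (\<Sum>(j, (b1, t1), (b2, t2))\<in>?S. z ^ contacts b1 * z ^ contacts b2)"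
    by (subst sum.Sigma) (auto simp: finite_path_pairs)
  also have "\<dots> = (\<Sum>(b, t)\<in>?T. z ^ contacts b)"
  proof (rule sum.reindex_bij_witness[where j = ?join and i = ?split])
    fix x assume x: "x \<in> ?S"
    obtain j b1 t1 b2 t2 where xe: "x = (j, (b1, t1), (b2, t2))" by (metis surj_pair)
    have 1: "(b1, t1) \<in> path_pairs q j" and 2: "(b2, t2) \<in> path_pairs (n - q) j"
      using x by (auto simp: xe)
    have len: "length b1 = Suc (2 * q)" "length t1 = Suc (2 * q)"
      using path_pairs_length[OF 1] by auto
    have b1: "b1 \<in> paths (0, 0) (2 * int q, 0)" and b2: "b2 \<in> paths (0, 0) (2 * int (n - q), 0)"
      and t1: "t1 \<in> paths (0, 2) (2 * int q, 2 * int j + 2)"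
      and t2: "t2 \<in> paths (0, 2) (2 * int (n - q), 2 * int j + 2)"
      using 1 2 by (auto simp: path_pairs_def)
    have rb: "rev_path n b2 \<in> paths (2 * int q, 0) (2 * int n, 0)"
      using rev_path_paths[OF b2, of n] q by (simp add: reflect_def of_nat_diff)
    have rt: "rev_path n t2 \<in> paths (2 * int q, 2 * int j + 2) (2 * int n, 2)"
      using rev_path_paths[OF t2, of n] q by (simp add: reflect_def of_nat_diff)
    have glue: "drop (2 * q) (p @ tl r) = r"
      if "p \<in> paths u v" "r \<in> paths v w" "length p = Suc (2 * q)" for p r u v w
    proof -
      have "drop (2 * q) p = [v]"
        using that(3) paths_nth_last[OF that(1)] by (simp add: Cons_nth_drop_Suc[symmetric])
      then show ?thesis using that by (cases r) (auto simp: paths_def)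
    qed
    have tq: "(t1 @ tl (rev_path n t2)) ! (2 * q) = (2 * int q, 2 * int j + 2)"
      using paths_nth_last[OF t1] len by (simp add: nth_append)
    show "?split (?join x) = x"
      using glue[OF b1 rb len(1)] glue[OF t1 rt len(2)] tq len by (simp add: xe)
    show "?join x \<in> ?T"
      using join_path_pairs[OF q 1 2] by (simp add: xe)
    show "(\<lambda>(b, t). z ^ contacts b) (?join x)
        = (\<lambda>(j, (b1, t1), (b2, t2)). z ^ contacts b1 * z ^ contacts b2) x"
      using contacts_append[OF q b1 b2] by (simp add: xe power_add)
  next
    fix y assume y: "y \<in> ?T"
    obtain b t where ye: "y = (b, t)" by (metis surj_pair)
    have bt: "(b, t) \<in> path_pairs n 0" and pin: "(2 * int q, 0) \<in> set b" using y by (auto simp: ye)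
    obtain j where j: "j \<le> n" "t ! (2 * q) = (2 * int q, 2 * int j + 2)"
      "(take (Suc (2 * q)) b, take (Suc (2 * q)) t) \<in> path_pairs q j"
      "(rev_path n (drop (2 * q) b), rev_path n (drop (2 * q) t)) \<in> path_pairs (n - q) j"
      using split_path_pairs[OF q bt pin] by blast
    show "?split y \<in> ?S" using j by (simp add: ye)
    have "take (Suc (2 * q)) p @ tl (drop (2 * q) p) = p" for p :: "vertex list"
      by (metis append_take_drop_id drop_Suc tl_drop)
    then show "?join (?split y) = y" by (simp add: ye)
  qed
  finally show ?thesis by (simp add: Zstar_def)
qed

end

(*
  Appending two steps to a walk turns a walk from height 2 into one from height 0, so by a
  determinant of weighted one-walk counts, C n z j = mu_n N_{n+1} - mu_{n+1} N_n, where mu_n and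
  N_n count walks of length 2n from height 0 to heights 0 and 2j+2. Concatenating walks
  evaluates the sum over j, and both C n z 0 and Zstar n z q become polynomials in the mu's:
  in terms of m_n = mu_n / 4^n and its backward differences d, d^2 they are, up to a common factor,
    m_n d^2 m_n - (d m_n)^2   and
    m_q m_r d^2 m_n - d m_n (m_q d m_r + d m_q m_r) + d m_q d m_r m_n,   r = n - q.
  It remains to find n^(k+3/2) d^k m_n for k <= 2. Comparison with z = 1 gives
    (2-z)^2 m_n = z c_n + 4 (1-z) d m_n,   c_n = Catalan_n / 4^n.
  The differences d^k m are nonnegative: for even k they are values of the Gram form of the
  walk vectors, for odd k this follows because m is bounded. Hence d^3 m = O(d^3 c) is
  negligible, and the recurrence yields d^2 m, d m and m in turn.
*)

theory Submission
  imports Defs "HOL-Analysis.Gamma_Function" "HOL-Real_Asymp.Real_Asymp"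
begin

subsection \<open>Walks on the half line\<close>

text \<open>The total weight of \<open>m\<close>-step walks on the half line from height 0 to height
  \<open>y\<close>, where each step into height 0 carries \<open>z\<close>. The start is not
  weighted, in accordance with \<open>contacts\<close>. The recursion removes the last step.\<close>

fun walk :: "real \<Rightarrow> nat \<Rightarrow> nat \<Rightarrow> real" where
  "walk z 0 y = (if y = 0 then 1 else 0)"
| "walk z (Suc m) 0 = z * walk z m (Suc 0)"
| "walk z (Suc m) (Suc y) = walk z m y + walk z m (Suc (Suc y))"

lemma walk_eq_0: "m < y \<or> odd (m + y) \<Longrightarrow> walk z m y = 0"
  by (induction z m y rule: walk.induct) (auto simp: odd_pos)

lemma walk_nonneg: "0 \<le> z \<Longrightarrow> 0 \<le> walk z m y"
  by (induction z m y rule: walk.induct) auto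

text \<open>The factor of \<open>2 ^ m\<close> is the affine function 1 + (2 - z) y / z, an
  eigenvector of the step recursion with eigenvalue 2. It is positive because z < 2, so domination
  at \<open>m = 0\<close> persists. The induction needs every height; height 0 gives the boundedness
  of \<open>returns\<close>.\<close>

lemma walk_le:
  assumes "0 < z" "z < 2"
  shows "walk z m y \<le> 2 ^ m * (if y = 0 then 1 else ((2 - z) * real y + z) / z)"
proof (induction m arbitrary: y)
  case 0
  then show ?case using assms by (auto intro!: divide_nonneg_pos add_nonneg_nonneg)
next
  case (Suc m)
  show ?case
  proof (cases y)
    case 0
    have "z * walk z m (Suc 0) \<le> z * (2 ^ m * (((2 - z) * real (Suc 0) + z) / z))"
      using Suc[of "Suc 0"] assms by (intro mult_left_mono) auto
    then show ?thesis using 0 assms by (simp add: field_simps)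
  next
    case (Suc y')
    have "walk z m y' + walk z m (Suc (Suc y')) \<le>
        2 ^ m * (((2 - z) * real y' + z) / z) + 2 ^ m * (((2 - z) * real (Suc (Suc y')) + z) / z)"
      using Suc.IH[of y'] Suc.IH[of "Suc (Suc y')"] assms
      by (intro add_mono) (auto split: if_splits)
    also have "\<dots> = 2 ^ Suc m * (((2 - z) * real y + z) / z)"
      using assms by (simp add: Suc field_simps)
    finally show ?thesis by (simp add: Suc)
  qed
qed

text \<open>The right-hand side obeys the recursion for weight 1. The only critical height is 0,
  where, writing w for the values of \<open>walk z m\<close>, z w(1) + (1 - z) (w(1) + w(3)) = w(1)
  + (1 - z) w(3).\<close>

lemma walk_one_eq: "walk 1 m y = walk z m y + (1 - z) * walk z m (y + 2)"
proof (induction m arbitrary: y)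
  case (Suc m)
  show ?case
    using Suc[of "Suc 0"] Suc[of "y - 1"] Suc[of "Suc y"]
    by (cases y) (auto simp: algebra_simps)
qed auto

text \<open>These are the ballot numbers, by induction on the length \<open>y + 2 * k\<close>;
  \<open>y = 0\<close> gives the Catalan numbers.\<close>

lemma walk_one_closed_form:
  "walk 1 (y + 2 * k) y = fact (y + 2 * k) * real (y + 1) / (fact k * fact (y + k + 1))"
proof (induction "y + 2 * k" arbitrary: y k)
  case 0
  then show ?case by simp
next
  case (Suc m)
  \<comment> \<open>The last step comes only from height 1 if \<open>y = 0\<close>, only from below
    if \<open>k = 0\<close> (the walk goes straight up), and otherwise from both neighbours.\<close>
  consider (a) "y = 0" "k > 0" | (b) y' where "y = Suc y'" "k = 0" | (c) y' k' where "y = Suc y'" "k = Suc k'"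
    using Suc.hyps(2) by (cases y; cases k) auto
  then show ?case
  proof cases
    case a
    then obtain k' where k: "k = Suc k'" by (cases k) auto
    have "walk 1 (1 + 2 * k') 1 = fact (1 + 2 * k') * real (1 + 1) / (fact k' * fact (1 + k' + 1))"
      by (rule Suc.hyps(1)) (use Suc.hyps(2) a k in auto)
    moreover have "walk 1 (y + 2 * k) y = walk 1 (1 + 2 * k') 1" using a k by simp
    moreover have "fact (1 + 2 * k') * real (1 + 1) / (fact k' * fact (1 + k' + 1)) =
        fact (y + 2 * k) * real (y + 1) / (fact k * fact (y + k + 1))"
    proof -
      have 1: "fact (y + 2 * k) = 2 * real (Suc k') * fact (1 + 2 * k')" 
        and 2: "fact k = real (Suc k') * fact k'"
        and 3: "y + k + 1 = 1 + k' + 1" "y + 1 = 1"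
        using a k by (simp_all add: algebra_simps)
      show ?thesis unfolding 1 2 3 by (simp del: fact_Suc of_nat_Suc)
    qed
    ultimately show ?thesis by simp
  next
    case b
    have "walk 1 (y' + 2 * 0) y' = fact (y' + 2 * 0) * real (y' + 1) / (fact 0 * fact (y' + 0 + 1))"
      by (rule Suc.hyps(1)) (use Suc.hyps(2) b in auto)
    then show ?thesis using b walk_eq_0[of y' "Suc (Suc y')" 1] by (simp add: divide_simps)
  next
    case c
    have "walk 1 (y' + 2 * k) y' = fact (y' + 2 * k) * real (y' + 1) / (fact k * fact (y' + k + 1))"
      by (rule Suc.hyps(1)) (use Suc.hyps(2) c in auto)
    moreover have "walk 1 (y' + 2 + 2 * k') (y' + 2) =
        fact (y' + 2 + 2 * k') * real (y' + 2 + 1) / (fact k' * fact (y' + 2 + k' + 1))"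
      by (rule Suc.hyps(1)) (use Suc.hyps(2) c in auto)
    moreover have "walk 1 (y + 2 * k) y = walk 1 (y' + 2 * k) y' + walk 1 (y' + 2 + 2 * k') (y' + 2)"
      using c by simp
    moreover have "fact (y' + 2 * k) * real (y' + 1) / (fact k * fact (y' + k + 1)) +
        fact (y' + 2 + 2 * k') * real (y' + 2 + 1) / (fact k' * fact (y' + 2 + k' + 1)) =
        fact (y + 2 * k) * real (y + 1) / (fact k * fact (y + k + 1))"
    proof -
      define F where "F = (fact (y' + 2 * k' + 2) :: real)"
      define f where "f = (fact k' :: real)"
      define h where "h = (fact (y' + k' + 2) :: real)"
      have pos: "f > 0" "h > 0" by (simp_all add: f_def h_def)
      have "y' + 2 * k = y' + 2 * k' + 2" "y' + 2 + 2 * k' = y' + 2 * k' + 2"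
        "y + 2 * k = Suc (y' + 2 * k' + 2)" "y' + k + 1 = y' + k' + 2"
        "y' + 2 + k' + 1 = Suc (y' + k' + 2)" "y + k + 1 = Suc (y' + k' + 2)"
        using c by simp_all
      then have 1: "fact (y' + 2 * k) = F" "fact (y' + 2 + 2 * k') = F"
        "fact (y + 2 * k) = (real y' + 2 * real k' + 3) * F" "fact (y' + k + 1) = h"
        "fact (y' + 2 + k' + 1) = (real y' + real k' + 3) * h"
        "fact (y + k + 1) = (real y' + real k' + 3) * h" "fact k = (real k' + 1) * f"
        unfolding F_def f_def h_def using c
        by (simp_all only: fact_Suc) (simp_all add: algebra_simps del: fact_Suc)
      have "real y' + real k' + 3 \<noteq> 0" "real k' + 1 \<noteq> 0" by linarith+
      then show ?thesis unfolding 1 f_def[symmetric] using pos c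
        by (simp add: divide_simps) (simp add: algebra_simps)
    qed
    ultimately show ?thesis by simp
  qed
qed

section \<open>The symmetric form of the walk and Hankel positivity\<close>

definition walk_form :: "real \<Rightarrow> nat \<Rightarrow> nat \<Rightarrow> nat \<Rightarrow> real" where
  "walk_form z N p q = walk z p 0 * walk z q 0 + z * (\<Sum>y<N. walk z p (Suc y) * walk z q (Suc y))"

text \<open>The weights 1 at height 0 and \<open>z\<close> above it make the step operator
  self-adjoint. The bounds on \<open>p\<close> and \<open>q\<close> keep all walks involved below
  the cutoff \<open>N\<close>.\<close>

lemma walk_form_shift:
  assumes "p < N" "q < N"
  shows "walk_form z N (Suc p) q = walk_form z N p (Suc q)"
proof -
  define X where "X p q = (\<Sum>y<N. walk z p y * walk z q (Suc y))" for p q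
  define Y where "Y p q = (\<Sum>y<N. walk z p (Suc (Suc y)) * walk z q (Suc y))" for p q
  \<comment> \<open>Shifting the summation index by one turns upward products into downward products
    with the roles of \<open>p\<close> and \<open>q\<close> exchanged. The term at the top height
    vanishes since neither walk reaches it.\<close>
  have XY: "X p q = walk z p 0 * walk z q (Suc 0) + Y q p" if pq: "p < N" "q < N" for p q
  proof -
    obtain M where M: "N = Suc M" using pq by (cases N) auto
    have "Y q p = (\<Sum>y<M. walk z q (Suc (Suc y)) * walk z p (Suc y))"
      using pq unfolding Y_def M by (simp add: walk_eq_0)
    then show ?thesis unfolding X_def M sum.lessThan_Suc_shift by (simp add: mult.commute)
  qed
  have form: "walk_form z N (Suc p) q = z * (walk z p (Suc 0) * walk z q 0 + X p q + Y p q)" for p q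
    unfolding walk_form_def X_def Y_def by (simp add: algebra_simps sum.distrib)
  have "walk_form z N p (Suc q) = walk_form z N (Suc q) p"
    by (simp add: walk_form_def mult.commute)
  then show ?thesis
    using XY[OF assms] XY[OF assms(2,1)] by (simp add: form algebra_simps)
qed

text \<open>Symmetry moves the steps of the second walk one at a time to the first, until the second
  is the unit vector at height 0.\<close>

lemma walk_form_eq:
  assumes "p + q \<le> N"
  shows "walk_form z N p q = walk z (p + q) 0"
  using assms
proof (induction q arbitrary: p)
  case 0
  then show ?case by (simp add: walk_form_def)
next
  case (Suc q)
  then show ?case using walk_form_shift[of p N q z] Suc.IH[of "Suc p"] by simp
qed

text \<open>The Hankel matrix of the return weights is a Gram matrix for \<open>walk_form\<close>,
  which is positive semidefinite for nonnegative \<open>z\<close>.\<close>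

lemma walk_hankel_nonneg:
  assumes "0 \<le> z" "finite I"
  shows "0 \<le> (\<Sum>i\<in>I. \<Sum>j\<in>I. u i * u j * walk z (i + j) 0)"
proof -
  \<comment> \<open>One cutoff that exceeds every \<open>i + j\<close>; inserting 0 keeps the
    argument of \<open>Max\<close> nonempty.\<close>
  define N where "N = 2 * Max (insert 0 I)"
  define v where "v y = (\<Sum>i\<in>I. u i * walk z i y)" for y
  have N: "i + j \<le> N" if "i \<in> I" "j \<in> I" for i j
  proof -
    have "i \<le> Max (insert 0 I)" "j \<le> Max (insert 0 I)" using that assms(2) by (auto intro!: Max_ge)
    then show ?thesis by (simp add: N_def)
  qed
  have v: "v y * v y = (\<Sum>i\<in>I. \<Sum>j\<in>I. u i * u j * (walk z i y * walk z j y))" for y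
    unfolding v_def sum_product by (simp add: algebra_simps)
  have "(\<Sum>i\<in>I. \<Sum>j\<in>I. u i * u j * walk z (i + j) 0) =
      (\<Sum>i\<in>I. \<Sum>j\<in>I. u i * u j * walk_form z N i j)"
    by (intro sum.cong refl) (simp add: walk_form_eq N)
  also have "\<dots> = (\<Sum>i\<in>I. \<Sum>j\<in>I. u i * u j * (walk z i 0 * walk z j 0)) +
      z * (\<Sum>i\<in>I. \<Sum>j\<in>I. \<Sum>y<N. u i * u j * (walk z i (Suc y) * walk z j (Suc y)))"
    by (simp add: walk_form_def distrib_left sum.distrib sum_distrib_left mult.left_commute)
  also have "(\<Sum>i\<in>I. \<Sum>j\<in>I. \<Sum>y<N. u i * u j * (walk z i (Suc y) * walk z j (Suc y))) =
      (\<Sum>y<N. v (Suc y) * v (Suc y))"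
    unfolding v by (subst sum.swap[of _ _ "{..<N}"], subst sum.swap[of _ "{..<N}"]) simp
  finally show ?thesis using assms by (simp add: v[symmetric] sum_nonneg)
qed

subsection \<open>Pairs of walks\<close>

text \<open>Unlike \<open>path_pairs\<close>, this allows odd lengths and arbitrary end heights, so
  that single steps can be removed.\<close>

definition walk_pairs :: "nat \<Rightarrow> int \<Rightarrow> int \<Rightarrow> (vertex list \<times> vertex list) set" where
  "walk_pairs m x y =
     {(b, t). b \<in> paths (0, 0) (int m, x) \<and> (\<forall>v\<in>set b. snd v \<ge> 0) \<and>
              t \<in> paths (0, 2) (int m, y) \<and> set b \<inter> set t = {}}"

definition pair_weight :: "real \<Rightarrow> nat \<Rightarrow> int \<Rightarrow> int \<Rightarrow> real" where
  "pair_weight z m x y = (\<Sum>(b, t)\<in>walk_pairs m x y. z ^ contacts b)"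

lemma finite_walk_pairs: "finite (walk_pairs m x y)"
  by (rule finite_subset[of _ "paths (0, 0) (int m, x) \<times> paths (0, 2) (int m, y)"])
     (auto simp: walk_pairs_def intro: finite_paths)

section \<open>Transfer recursion: removing the last vertex of each path\<close>

lemma paths_0_iff: "p \<in> paths u (fst u, y) \<longleftrightarrow> p = [u] \<and> y = snd u"
proof
  assume p: "p \<in> paths u (fst u, y)"
  then have "length p = 1" using paths_length[OF p] by simp
  then show "p = [u] \<and> y = snd u" using p by (auto simp: length_Suc_conv paths_def)
qed (auto simp: paths_def)

lemma paths_Suc_iff:
  "p \<in> paths (0, h) (int (Suc m), y) \<longleftrightarrow>
     (\<exists>p'. \<exists>y'\<in>{y - 1, y + 1}. p = p' @ [(int (Suc m), y)] \<and> p' \<in> paths (0, h) (int m, y'))"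
proof
  assume p: "p \<in> paths (0, h) (int (Suc m), y)"
  have ne: "p \<noteq> []" using p by (simp add: paths_def)
  define p' where "p' = butlast p"
  have p_eq: "p = p' @ [(int (Suc m), y)]"
    using p ne unfolding p'_def paths_def by (auto dest: append_butlast_last_id)
  have "p' \<noteq> []"
    using paths_length[OF p] by (auto simp: p_eq)
  then have "hd p' = (0, h)" "successively lattice_step p'" "lattice_step (last p') (int (Suc m), y)"
    using p by (auto simp: p_eq paths_def successively_append_iff)
  then show "\<exists>p'. \<exists>y'\<in>{y - 1, y + 1}. p = p' @ [(int (Suc m), y)] \<and> p' \<in> paths (0, h) (int m, y')"
    using p_eq \<open>p' \<noteq> []\<close>
    by (intro exI[of _ p'] bexI[of _ "snd (last p')"])
      (auto simp: paths_def lattice_step_iff prod_eq_iff)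
next
  assume "\<exists>p'. \<exists>y'\<in>{y - 1, y + 1}. p = p' @ [(int (Suc m), y)] \<and> p' \<in> paths (0, h) (int m, y')"
  then show "p \<in> paths (0, h) (int (Suc m), y)"
    by (auto simp: paths_def successively_append_iff lattice_step_iff)
qed

text \<open>The two new vertices lie to the right of all earlier ones, so they can only meet each
  other. The assumptions on \<open>x\<close> and \<open>y\<close> are exactly the conditions on this
  last column.\<close>

lemma walk_pairs_Suc:
  assumes "0 \<le> x" "x \<noteq> y"
  shows "walk_pairs (Suc m) x y = (\<lambda>(b, t). (b @ [(int (Suc m), x)], t @ [(int (Suc m), y)])) `
    (\<Union>(x', y')\<in>{x - 1, x + 1} \<times> {y - 1, y + 1}. walk_pairs m x' y')" (is "_ = ?f ` ?U")
proof (intro equalityI subsetI)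
  fix bt assume "bt \<in> walk_pairs (Suc m) x y"
  then obtain b t where bt: "bt = (b, t)" "b \<in> paths (0, 0) (int (Suc m), x)" "\<forall>v\<in>set b. snd v \<ge> 0"
     "t \<in> paths (0, 2) (int (Suc m), y)" "set b \<inter> set t = {}"
    by (auto simp: walk_pairs_def)
  obtain b' x' where b': "x' \<in> {x - 1, x + 1}" "b = b' @ [(int (Suc m), x)]" "b' \<in> paths (0, 0) (int m, x')"
    using bt(2) unfolding paths_Suc_iff by blast
  obtain t' y' where t': "y' \<in> {y - 1, y + 1}" "t = t' @ [(int (Suc m), y)]" "t' \<in> paths (0, 2) (int m, y')"
    using bt(4) unfolding paths_Suc_iff by blast
  have "(b', t') \<in> walk_pairs m x' y'" using bt b' t' by (auto simp: walk_pairs_def)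
  then have "(b', t') \<in> ?U" using b'(1) t'(1) by blast
  moreover have "bt = ?f (b', t')" using bt(1) b'(2) t'(2) by simp
  ultimately show "bt \<in> ?f ` ?U" by blast
next
  fix bt assume "bt \<in> ?f ` ?U"
  then obtain b' t' x' y' where bt: "bt = (b' @ [(int (Suc m), x)], t' @ [(int (Suc m), y)])"
    "x' \<in> {x - 1, x + 1}" "y' \<in> {y - 1, y + 1}" "(b', t') \<in> walk_pairs m x' y'"
    by auto
  have b': "b' \<in> paths (0, 0) (int m, x')" and t': "t' \<in> paths (0, 2) (int m, y')"
    and other: "\<forall>v\<in>set b'. snd v \<ge> 0" "set b' \<inter> set t' = {}"
    using bt(4) by (auto simp: walk_pairs_def)
  have "(int (Suc m), h) \<notin> set b'" "(int (Suc m), h) \<notin> set t'" for h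
    using paths_fst_range(2)[OF b'] paths_fst_range(2)[OF t'] by force+
  then have "set (b' @ [(int (Suc m), x)]) \<inter> set (t' @ [(int (Suc m), y)]) = {}"
    using other(2) assms(2) by auto
  moreover have "b' @ [(int (Suc m), x)] \<in> paths (0, 0) (int (Suc m), x)"
    "t' @ [(int (Suc m), y)] \<in> paths (0, 2) (int (Suc m), y)"
    unfolding paths_Suc_iff using b' t' bt(2,3) by blast+
  ultimately show "bt \<in> walk_pairs (Suc m) x y"
    using other(1) assms(1) by (auto simp: walk_pairs_def bt(1))
qed

lemma contacts_snoc:
  assumes "b \<in> paths (0, 0) (int m, x')"
  shows "contacts (b @ [(int (Suc m), x)]) = contacts b + (if x = 0 then 1 else 0)"
proof -
  have new: "(int (Suc m), x) \<notin> set b"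
    using paths_fst_range(2)[OF assms] by force
  have "{v \<in> set (b @ [(int (Suc m), x)]). snd v = 0 \<and> v \<noteq> (0, 0)} =
      (if x = 0 then insert (int (Suc m), x) {v \<in> set b. snd v = 0 \<and> v \<noteq> (0, 0)}
       else {v \<in> set b. snd v = 0 \<and> v \<noteq> (0, 0)})"
    by auto
  then show ?thesis using new by (cases "x = 0") (simp_all add: contacts_def del: of_nat_Suc)
qed

lemma pair_weight_Suc:
  assumes "0 \<le> x" "x \<noteq> y"
  shows "pair_weight z (Suc m) x y = (if x = 0 then z else 1) *
    (pair_weight z m (x - 1) (y - 1) + pair_weight z m (x - 1) (y + 1) +
     pair_weight z m (x + 1) (y - 1) + pair_weight z m (x + 1) (y + 1))"
proof -
  let ?f = "\<lambda>(b, t). (b @ [(int (Suc m), x)], t @ [(int (Suc m), y)])"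
  let ?I = "{x - 1, x + 1} \<times> {y - 1, y + 1}"
  let ?P = "\<lambda>(x', y'). walk_pairs m x' y'"
  have "pair_weight z (Suc m) x y = (\<Sum>bt\<in>(\<Union>i\<in>?I. ?P i). z ^ contacts (fst (?f bt)))"
    unfolding pair_weight_def walk_pairs_Suc[OF assms]
    by (subst sum.reindex) (auto simp: inj_on_def case_prod_unfold)
  also have "\<dots> = (\<Sum>i\<in>?I. \<Sum>bt\<in>?P i. z ^ contacts (fst (?f bt)))"
  proof (rule sum.UNION_disjoint)
    show "\<forall>i\<in>?I. finite (?P i)" by (simp add: finite_walk_pairs)
    \<comment> \<open>The last vertices of a pair determine the end heights, so the pieces of the
      union are disjoint.\<close>
    have "?P i \<inter> ?P j = {}" if "i \<noteq> j" for i j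
      using that by (cases i; cases j) (auto simp: walk_pairs_def paths_def)
    then show "\<forall>i\<in>?I. \<forall>j\<in>?I. i \<noteq> j \<longrightarrow> ?P i \<inter> ?P j = {}" by blast
  qed simp
  also have "\<dots> = (\<Sum>i\<in>?I. \<Sum>(b, t)\<in>?P i. (if x = 0 then z else 1) * z ^ contacts b)"
    by (intro sum.cong refl) (auto simp: walk_pairs_def contacts_snoc simp del: of_nat_Suc)
  also have "\<dots> = (if x = 0 then z else 1) * (\<Sum>i\<in>?I. case i of (x', y') \<Rightarrow> pair_weight z m x' y')"
    by (simp only: pair_weight_def sum_distrib_left case_prod_unfold)
  also have "(\<Sum>i\<in>?I. case i of (x', y') \<Rightarrow> pair_weight z m x' y') =
      (\<Sum>x'\<in>{x - 1, x + 1}. \<Sum>y'\<in>{y - 1, y + 1}. pair_weight z m x' y')"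
    by (simp add: sum.cartesian_product)
  finally show ?thesis by (simp add: algebra_simps)
qed

text \<open>The boundary values of the recursion: the last vertex of the bottom path would lie below
  the line, or on the top path.\<close>

lemma pair_weight_eq_0: "x < 0 \<or> x = y \<Longrightarrow> pair_weight z m x y = 0"
proof -
  assume xy: "x < 0 \<or> x = y"
  have end_in: "(int m, h) \<in> set p" if "p \<in> paths u (int m, h)" for p u h
    using that last_in_set[of p] by (auto simp: paths_def)
  have "\<not> (b \<in> paths (0, 0) (int m, x) \<and> (\<forall>v\<in>set b. snd v \<ge> 0) \<and>
      t \<in> paths (0, 2) (int m, y) \<and> set b \<inter> set t = {})" for b t
    using xy end_in[of b "(0, 0)" x] end_in[of t "(0, 2)" y] by force
  then have "walk_pairs m x y = {}" by (simp add: walk_pairs_def)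
  then show ?thesis by (simp add: pair_weight_def)
qed

text \<open>The top path starts at height 2. Two steps from height 0 lead to height 2, or back to height 0
  with weight \<open>z\<close>; the latter contribution is a multiple of \<open>walk z m\<close> and cancels in the determinant.\<close>

lemma pair_weight_eq_det:
  assumes "x \<le> y" "even (x + y)"
  shows "pair_weight z m (int x) (int y) =
    walk z m x * walk z (Suc (Suc m)) y - walk z (Suc (Suc m)) x * walk z m y"
  using assms
proof (induction m arbitrary: x y)
  case 0
  have "walk_pairs 0 (int x) (int y) = (if x = 0 \<and> y = 2 then {([(0, 0)], [(0, 2)])} else {})"
    using paths_0_iff[of _ "(0, 0)"] paths_0_iff[of _ "(0, 2)"] by (auto simp: walk_pairs_def)
  then have "pair_weight z 0 (int x) (int y) = (if x = 0 \<and> y = 2 then 1 else 0)"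
  proof -
    have "{v \<in> set [(0, 0) :: vertex]. snd v = 0 \<and> v \<noteq> (0, 0)} = {}" by auto
    then have "contacts [(0, 0)] = 0" unfolding contacts_def by (simp only: card.empty)
    then show ?thesis by (simp add: pair_weight_def \<open>walk_pairs 0 (int x) (int y) = _\<close>)
  qed
  moreover have "walk z 0 x * walk z (Suc (Suc 0)) y - walk z (Suc (Suc 0)) x * walk z 0 y =
      (if x = 0 \<and> y = 2 then 1 else 0)"
  proof (cases "x = 0 \<and> y \<le> 2")
    case True
    then have "x = 0" "y = 0 \<or> y = 2" using 0 by presburger+
    then show ?thesis by (auto simp: numeral_2_eq_2)
  next
    case False
    then have "walk z 0 x = 0 \<or> walk z (Suc (Suc 0)) y = 0" "walk z 0 y = 0"
      using 0 by (auto simp: walk_eq_0 simp del: walk.simps(2,3))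
    then show ?thesis using False by auto
  qed
  ultimately show ?case by (simp only:)
next
  case (Suc m)
  let ?D = "\<lambda>m x y. walk z m x * walk z (Suc (Suc m)) y - walk z (Suc (Suc m)) x * walk z m y"
  have step: "walk z (Suc k) 0 = z * walk z k 1"
    "walk z (Suc k) (Suc h) = walk z k h + walk z k (h + 2)" for k h
    by simp_all
  \<comment> \<open>Both sides vanish on the diagonal. Off it, parity gives x + 2 \<le> y, so all
    predecessors at nonnegative heights still satisfy the ordering required by the induction
    hypothesis.\<close>
  consider "x = y" | (bot) y' where "x = 0" "y = Suc y'" "even (1 + y')" "1 \<le> y'"
    | (up) x' y' where "x = Suc x'" "y = Suc y'" "x' + 2 \<le> y'" "even (x' + y')"
  proof (cases "x = y")
    case False
    then have "x + 2 \<le> y" using Suc.prems by presburger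
    moreover then obtain y' where "y = Suc y'" by (cases y) auto
    ultimately show thesis using Suc.prems(2) bot up by (cases x) auto
  qed
  then show ?case
  proof cases
    case 1
    then show ?thesis by (simp add: pair_weight_eq_0)
  next
    case bot
    have "pair_weight z (Suc m) (int x) (int y) =
        z * (pair_weight z m (int 1) (int y') + pair_weight z m (int 1) (int (y' + 2)))"
    proof -
      have shift: "int x - 1 = -1" "int x + 1 = int 1" "int y - 1 = int y'" "int y + 1 = int (y' + 2)"
        using bot by auto
      have "0 \<le> int x" "int x \<noteq> int y" using bot by auto
      from pair_weight_Suc[OF this] show ?thesis
        unfolding shift using bot(1) by (simp add: pair_weight_eq_0 del: of_nat_Suc of_nat_add)
    qed
    also have "\<dots> = z * (?D m 1 y' + ?D m 1 (y' + 2))"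
      using bot Suc.IH[of 1 y'] Suc.IH[of 1 "y' + 2"] by simp
    also have "\<dots> = ?D (Suc m) x y" unfolding bot step by (simp only: algebra_simps)
    finally show ?thesis .
  next
    case up
    have "pair_weight z (Suc m) (int x) (int y) =
        pair_weight z m (int x') (int y') + pair_weight z m (int x') (int (y' + 2)) +
        pair_weight z m (int (x' + 2)) (int y') + pair_weight z m (int (x' + 2)) (int (y' + 2))"
    proof -
      have shift: "int x - 1 = int x'" "int x + 1 = int (x' + 2)" "int y - 1 = int y'" "int y + 1 = int (y' + 2)"
        using up by auto
      have "0 \<le> int x" "int x \<noteq> int y" using up by auto
      from pair_weight_Suc[OF this] show ?thesis
        unfolding shift using up(1) by (simp del: of_nat_Suc of_nat_add)
    qed
    also have "\<dots> = ?D m x' y' + ?D m x' (y' + 2) + ?D m (x' + 2) y' + ?D m (x' + 2) (y' + 2)"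
      using up Suc.IH[of x' y'] Suc.IH[of x' "y' + 2"] Suc.IH[of "x' + 2" y'] Suc.IH[of "x' + 2" "y' + 2"] by simp
    also have "\<dots> = ?D (Suc m) x y" unfolding up step by (simp only: algebra_simps)
    finally show ?thesis .
  qed
qed

section \<open>Single-walk formulas for \<open>C\<close> and for sums over the middle height\<close>

lemma C_eq_det:
  "C n z j = walk z (2 * n) 0 * walk z (2 * Suc n) (2 * j + 2) - walk z (2 * Suc n) 0 * walk z (2 * n) (2 * j + 2)"
proof -
  have "C n z j = pair_weight z (2 * n) (int 0) (int (2 * j + 2))"
    by (simp add: C_def pair_weight_def path_pairs_def walk_pairs_def algebra_simps)
  also have "\<dots> = walk z (2 * n) 0 * walk z (Suc (Suc (2 * n))) (2 * j + 2) -
      walk z (Suc (Suc (2 * n))) 0 * walk z (2 * n) (2 * j + 2)"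
    by (rule pair_weight_eq_det) auto
  finally show ?thesis by (simp only: mult_Suc_right add_2_eq_Suc)
qed

text \<open>This is \<open>walk_form_eq\<close> for even lengths with the height 0 term moved to the
  right. Odd heights contribute nothing, and terms with \<open>j > n\<close> vanish since the walks
  are too short.\<close>

lemma sum_walk_products:
  assumes "q \<le> n" "r \<le> n"
  shows "z * (\<Sum>j=0..n. walk z (2 * q) (2 * j + 2) * walk z (2 * r) (2 * j + 2)) =
    walk z (2 * (q + r)) 0 - walk z (2 * q) 0 * walk z (2 * r) 0"
proof -
  let ?f = "\<lambda>y. walk z (2 * q) (Suc y) * walk z (2 * r) (Suc y)"
  \<comment> \<open>Large enough both to extend the sum beyond \<open>n\<close> and to make
    \<open>2 * Suc M\<close> an admissible cutoff in \<open>walk_form_eq\<close>.\<close>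
  define M where "M = q + r + n"
  have even: "(\<Sum>y<2 * N. ?f y) = (\<Sum>j<N. walk z (2 * q) (2 * j + 2) * walk z (2 * r) (2 * j + 2))" for N
    by (induction N) (simp_all add: walk_eq_0)
  have "(\<Sum>j=0..n. walk z (2 * q) (2 * j + 2) * walk z (2 * r) (2 * j + 2)) =
      (\<Sum>j<Suc M. walk z (2 * q) (2 * j + 2) * walk z (2 * r) (2 * j + 2))"
    using assms by (intro sum.mono_neutral_left) (auto simp: walk_eq_0 M_def)
  then show ?thesis
    using walk_form_eq[of "2 * q" "2 * r" "2 * Suc M" z] unfolding even[symmetric]
    by (simp add: walk_form_def M_def algebra_simps)
qed

subsection \<open>Asymptotics of the return weights\<close>

text \<open>The sign is chosen so that all iterated differences of a completely monotone sequence
  are nonnegative.\<close>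

definition bdiff :: "(nat \<Rightarrow> real) \<Rightarrow> nat \<Rightarrow> real" where
  "bdiff f n = f n - f (Suc n)"

definition returns :: "real \<Rightarrow> nat \<Rightarrow> real" where
  "returns z n = walk z (2 * n) 0 / 4 ^ n"

lemma walk_0_eq_returns: "walk z (2 * n) 0 = 4 ^ n * returns z n"
  by (simp add: returns_def)

text \<open>Two steps before a return the walk is at height 0 or 2, which allows height 2 to be
  eliminated. The factor \<open>z\<close> avoids a division.\<close>

lemma walk_2_eq_returns:
  "z * walk z (2 * n) (2 * 0 + 2) = 4 ^ n * (4 * returns z (Suc n) - z * returns z n)"
  by (simp add: returns_def field_simps numeral_2_eq_2)

text \<open>After elimination of height 2 the terms containing \<open>z\<close> cancel, leaving the
  Hankel determinant m_n m_{n+2} - m_{n+1}^2 with m = \<open>returns z\<close>. Its two products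
  agree to leading order, and rewriting it in differences exposes its true order.\<close>

lemma C_0_eq_returns:
  "z * C n z 0 = 4 ^ (2 * n + 2) * (returns z n * bdiff (bdiff (returns z)) n - (bdiff (returns z) n)\<^sup>2)"
proof -
  have "z * C n z 0 = walk z (2 * n) 0 * (z * walk z (2 * Suc n) (2 * 0 + 2)) -
      walk z (2 * Suc n) 0 * (z * walk z (2 * n) (2 * 0 + 2))"
    unfolding C_eq_det by (simp only: algebra_simps)
  also have "\<dots> = 4 ^ (2 * n + 2) * (returns z n * bdiff (bdiff (returns z)) n - (bdiff (returns z) n)\<^sup>2)"
  proof -
    have pow: "(4::real) ^ (2 * n + 2) = 16 * 4 ^ n * 4 ^ n" "(4::real) ^ Suc n = 4 * 4 ^ n"
      by (simp_all add: power_add mult_2)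
    show ?thesis
      unfolding walk_2_eq_returns unfolding walk_0_eq_returns bdiff_def power2_eq_square pow
      by (simp only: algebra_simps)
  qed
  finally show ?thesis .
qed

text \<open>Expanding both determinants in the convolution leaves four sums over the middle height,
  each evaluated by \<open>sum_walk_products\<close>.\<close>

lemma Zstar_eq_returns:
  assumes "0 < q" "q < n" "z \<noteq> 0"
  shows "z * Zstar n z q = 4 ^ (2 * n + 2) *
    (returns z q * returns z (n - q) * bdiff (bdiff (returns z)) n
     - bdiff (returns z) n * (returns z q * bdiff (returns z) (n - q) + bdiff (returns z) q * returns z (n - q))
     + bdiff (returns z) q * bdiff (returns z) (n - q) * returns z n)"
proof -
  define r where "r = n - q"
  have qr: "Suc q \<le> n" "Suc r \<le> n" "q \<le> n" "r \<le> n" "n = q + r" using assms by (auto simp: r_def)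
  define W where "W k = walk z (2 * k) 0" for k
  define N where "N k j = walk z (2 * k) (2 * j + 2)" for k j
  have NN: "z * (\<Sum>j=0..n. N k j * N l j) = W (k + l) - W k * W l" if "k \<le> n" "l \<le> n" for k l
    unfolding N_def W_def using sum_walk_products[OF that] .
  have C: "C k z j = W k * N (Suc k) j - W (Suc k) * N k j" for k j
    unfolding W_def N_def by (rule C_eq_det)
  have "z * Zstar n z q = z * (\<Sum>j=0..n. C q z j * C r z j)"
    using Zstar_eq_sum[OF qr(3)] by (simp only: r_def)
  also have "\<dots> = W q * W r * (z * (\<Sum>j=0..n. N (Suc q) j * N (Suc r) j))
      - W q * W (Suc r) * (z * (\<Sum>j=0..n. N (Suc q) j * N r j))
      - W (Suc q) * W r * (z * (\<Sum>j=0..n. N q j * N (Suc r) j))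
      + W (Suc q) * W (Suc r) * (z * (\<Sum>j=0..n. N q j * N r j))"
    unfolding C by (simp add: sum_distrib_left sum.distrib sum_subtractf algebra_simps)
  \<comment> \<open>The subtracted products of two returns yield the same fourfold product with
    signs -, +, +, -, and cancel.\<close>
  also have "\<dots> = W q * W r * W (Suc (Suc n)) - (W q * W (Suc r) + W (Suc q) * W r) * W (Suc n)
      + W (Suc q) * W (Suc r) * W n"
  proof -
    have products: "z * (\<Sum>j=0..n. N (Suc q) j * N (Suc r) j) = W (Suc (Suc n)) - W (Suc q) * W (Suc r)"
      "z * (\<Sum>j=0..n. N (Suc q) j * N r j) = W (Suc n) - W (Suc q) * W r"
      "z * (\<Sum>j=0..n. N q j * N (Suc r) j) = W (Suc n) - W q * W (Suc r)"
      "z * (\<Sum>j=0..n. N q j * N r j) = W n - W q * W r"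
      using NN[OF qr(1,2)] NN[OF qr(1,4)] NN[OF qr(3,2)] NN[OF qr(3,4)]
      by (simp_all only: add_Suc add_Suc_right qr(5)[symmetric])
    show ?thesis unfolding products by (simp only: algebra_simps)
  qed
  also have "\<dots> = 4 ^ (2 * n + 2) *
    (returns z q * returns z r * bdiff (bdiff (returns z)) n
     - bdiff (returns z) n * (returns z q * bdiff (returns z) r + bdiff (returns z) q * returns z r)
     + bdiff (returns z) q * bdiff (returns z) r * returns z n)"
  proof -
    have pow: "(4::real) ^ n = 4 ^ q * 4 ^ r" "(4::real) ^ (2 * n + 2) = 16 * 4 ^ n * 4 ^ n"
      "\<And>k. (4::real) ^ Suc k = 4 * 4 ^ k"
      by (simp_all add: qr(5) power_add mult_2)
    show ?thesis
      unfolding W_def walk_0_eq_returns bdiff_def pow(3) unfolding pow(2) unfolding pow(1)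
      by (simp only: algebra_simps)
  qed
  finally show ?thesis unfolding r_def .
qed

section \<open>Boundedness and monotonicity of the return weights\<close>

lemma returns_nonneg: "0 \<le> z \<Longrightarrow> 0 \<le> returns z n"
  by (simp add: returns_def walk_nonneg)

lemma returns_le_1: "0 < z \<Longrightarrow> z < 2 \<Longrightarrow> returns z n \<le> 1"
  using walk_le[of z "2 * n" 0] by (simp add: returns_def power_mult)

text \<open>A convex sequence that once increases keeps increasing by at least the same amount,
  contradicting the upper bound.\<close>

lemma bdiff_nonneg:
  assumes "\<And>n. 0 \<le> bdiff (bdiff f) n" "\<And>n. f n \<le> B"
  shows "0 \<le> bdiff f n"
proof (rule ccontr)
  assume "\<not> 0 \<le> bdiff f n"
  then have neg: "bdiff f n < 0" by simp
  have dec: "bdiff f (n + k) \<le> bdiff f n" for k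
  proof (induction k)
    case (Suc k)
    then show ?case using assms(1)[of "n + k"] unfolding bdiff_def[of "bdiff f"] by simp
  qed simp
  have grow: "f (n + k) \<ge> f n - real k * bdiff f n" for k
  proof (induction k)
    case (Suc k)
    then show ?case using dec[of k] by (simp add: bdiff_def algebra_simps)
  qed simp
  obtain k where "B - f n < real k * (- bdiff f n)"
    using reals_Archimedean3[of "- bdiff f n"] neg by auto
  then show False using grow[of k] assms(2)[of "n + k"] by (simp add: algebra_simps)
qed

lemma bdiff_le: "(\<And>n. 0 \<le> f n) \<Longrightarrow> bdiff f n \<le> f n"
  by (simp add: bdiff_def)

lemma bdiff2_returns_nonneg:
  assumes "0 \<le> z"
  shows "0 \<le> bdiff (bdiff (returns z)) n"
proof -
  \<comment> \<open>The coefficients of t^n (1 - t^2/4). The square of this polynomial produces the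
    second difference, since two steps correspond to one index and a factor 4.\<close>
  define u where "u i = (if i = n then 1 else - 1 / 4 :: real)" for i
  have "0 \<le> (\<Sum>i\<in>{n, n + 2}. \<Sum>j\<in>{n, n + 2}. u i * u j * walk z (i + j) 0)"
    using assms by (intro walk_hankel_nonneg) auto
  also have "\<dots> = walk z (2 * n) 0 - walk z (2 * Suc n) 0 / 2 + walk z (2 * Suc (Suc n)) 0 / 16"
    by (simp add: u_def mult_2 del: walk.simps)
  also have "\<dots> = 4 ^ n * bdiff (bdiff (returns z)) n"
    unfolding walk_0_eq_returns by (simp add: bdiff_def algebra_simps)
  finally show ?thesis by (simp add: zero_le_mult_iff power_le_zero_eq)
qed

lemma bdiff4_returns_nonneg:
  assumes "0 \<le> z"
  shows "0 \<le> bdiff (bdiff (bdiff (bdiff (returns z)))) n"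
proof -
  \<comment> \<open>The coefficients of t^n (1 - t^2/4)^2, whose square produces the fourth
    difference.\<close>
  define u where "u i = (if i = n then 1 else if i = n + 2 then - 1 / 2 else 1 / 16 :: real)" for i
  have "0 \<le> (\<Sum>i\<in>{n, n + 2, n + 4}. \<Sum>j\<in>{n, n + 2, n + 4}. u i * u j * walk z (i + j) 0)"
    using assms by (intro walk_hankel_nonneg) auto
  also have "\<dots> = walk z (2 * n) 0 - walk z (2 * (n + 1)) 0 + 3 / 8 * walk z (2 * (n + 2)) 0
      - walk z (2 * (n + 3)) 0 / 16 + walk z (2 * (n + 4)) 0 / 256"
    by (simp add: u_def mult_2 eval_nat_numeral del: walk.simps)
  also have "\<dots> = 4 ^ n * bdiff (bdiff (bdiff (bdiff (returns z)))) n"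
    unfolding walk_0_eq_returns by (simp add: bdiff_def algebra_simps power_add numeral_eq_Suc)
  finally show ?thesis by (simp add: zero_le_mult_iff power_le_zero_eq)
qed

lemma bdiff1_returns_nonneg:
  assumes "0 < z" "z < 2"
  shows "0 \<le> bdiff (returns z) n"
  by (rule bdiff_nonneg) (use bdiff2_returns_nonneg[of z] returns_le_1[OF assms] assms in auto)

lemma bdiff3_returns_nonneg:
  assumes "0 < z" "z < 2"
  shows "0 \<le> bdiff (bdiff (bdiff (returns z))) n"
proof (rule bdiff_nonneg)
  \<comment> \<open>The difference of a nonnegative sequence is at most the sequence itself; applied
    twice, this passes the bound on \<open>returns z\<close> to its second difference.\<close>
  show "bdiff (bdiff (returns z)) n \<le> 1" for n
    using bdiff_le[of "bdiff (returns z)" n] bdiff_le[of "returns z" n] returns_le_1[OF assms, of n]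
      bdiff1_returns_nonneg[OF assms] returns_nonneg[of z] assms by force
qed (use bdiff4_returns_nonneg assms in auto)

lemma bdiff_mult_add:
  assumes "\<And>n. k * f n = u * g n + v * h n"
  shows "k * bdiff f n = u * bdiff g n + v * bdiff h n"
  using assms[of n] assms[of "Suc n"] by (simp add: bdiff_def algebra_simps)

text \<open>Height 2 is eliminated between \<open>walk_one_eq\<close> and
  \<open>walk_2_eq_returns\<close>; the coefficient arises as z + (1 - z) (4 - z) = (2 -
  z)^2.\<close>

lemma returns_recurrence:
  "(2 - z)\<^sup>2 * returns z n = z * returns 1 n + 4 * (1 - z) * bdiff (returns z) n"
proof -
  have "z * walk 1 (2 * n) 0 = z * walk z (2 * n) 0 + (1 - z) * (z * walk z (2 * n) (2 * 0 + 2))"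
  proof -
    have one: "walk 1 (2 * n) 0 = walk z (2 * n) 0 + (1 - z) * walk z (2 * n) (2 * 0 + 2)"
      using walk_one_eq[of "2 * n" 0 z] by simp
    show ?thesis unfolding one by (simp only: algebra_simps)
  qed
  then have "4 ^ n * (z * returns 1 n) = 4 ^ n * (z * returns z n + (1 - z) * (4 * returns z (Suc n) - z * returns z n))"
    unfolding walk_2_eq_returns unfolding walk_0_eq_returns by (simp add: algebra_simps)
  then have "z * returns 1 n = z * returns z n + (1 - z) * (4 * returns z (Suc n) - z * returns z n)"
    by simp
  then show ?thesis by (simp add: bdiff_def power2_eq_square algebra_simps)
qed

section \<open>The Catalan case z = 1\<close>

lemma returns_1_Suc: "returns 1 (Suc n) = returns 1 n * ((2 * real n + 1) / (2 * real n + 4))"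
proof -
  have closed: "returns 1 n = fact (2 * n) / (fact n * fact (Suc n) * 4 ^ n)" for n
    using walk_one_closed_form[of 0 n] by (simp add: returns_def)
  have 1: "fact (2 * Suc n) = (2 * real n + 2) * (2 * real n + 1) * fact (2 * n)"
    "fact (Suc n) = (real n + 1) * fact n" "fact (Suc (Suc n)) = (real n + 2) * ((real n + 1) * fact n)"
    by (simp_all add: algebra_simps)
  have "real n + 1 \<noteq> 0" "real n + 2 \<noteq> 0" "2 * real n + 4 \<noteq> 0" by linarith+
  then show ?thesis unfolding closed 1 by (simp add: divide_simps) (simp add: algebra_simps)
qed

text \<open>This form can be compared with \<open>Gamma_series\<close> at 1/2.\<close>

lemma returns_1_pochhammer: "returns 1 n = pochhammer (1 / 2) n / fact (Suc n)"
proof (induction n)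
  case (Suc n)
  have "2 * real n + 4 \<noteq> 0" by linarith
  then show ?case unfolding returns_1_Suc Suc by (simp add: pochhammer_Suc field_simps)
qed (simp add: returns_def)

text \<open>The k-th difference contributes the further factor (2k + 1) / (2n + 2k + 2), by the
  ratio in \<open>returns_1_Suc\<close>.\<close>

lemma bdiff_returns_1:
  "bdiff (returns 1) n = returns 1 n * (3 / (2 * real n + 4))"
  "bdiff (bdiff (returns 1)) n = returns 1 n * (15 / ((2 * real n + 4) * (2 * real n + 6)))"
  "bdiff (bdiff (bdiff (returns 1))) n =
     returns 1 n * (105 / ((2 * real n + 4) * (2 * real n + 6) * (2 * real n + 8)))"
proof -
  have nz: "2 * real n + 4 \<noteq> 0" "2 * real n + 6 \<noteq> 0" "2 * real n + 8 \<noteq> 0" for n by linarith+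
  have 1: "bdiff (returns 1) n = returns 1 n * (3 / (2 * real n + 4))" for n
    unfolding bdiff_def returns_1_Suc using nz[of n] by (simp add: divide_simps) (simp add: algebra_simps)
  have 2: "bdiff (bdiff (returns 1)) n = returns 1 n * (15 / ((2 * real n + 4) * (2 * real n + 6)))" for n
  proof -
    have "bdiff (bdiff (returns 1)) n = returns 1 n * (3 / (2 * real n + 4) -
        (2 * real n + 1) / (2 * real n + 4) * (3 / (2 * real n + 6)))"
      unfolding bdiff_def[of "bdiff (returns 1)"] 1 returns_1_Suc by (simp add: algebra_simps)
    also have "3 / (2 * real n + 4) - (2 * real n + 1) / (2 * real n + 4) * (3 / (2 * real n + 6)) =
        15 / ((2 * real n + 4) * (2 * real n + 6))"
      using nz[of n] by (simp add: divide_simps)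
    finally show ?thesis .
  qed
  have 3: "bdiff (bdiff (bdiff (returns 1))) n =
     returns 1 n * (105 / ((2 * real n + 4) * (2 * real n + 6) * (2 * real n + 8)))"
  proof -
    have "bdiff (bdiff (bdiff (returns 1))) n = returns 1 n * (15 / ((2 * real n + 4) * (2 * real n + 6)) -
        (2 * real n + 1) / (2 * real n + 4) * (15 / ((2 * real n + 6) * (2 * real n + 8))))"
      unfolding bdiff_def[of "bdiff (bdiff (returns 1))"] 2 returns_1_Suc by (simp add: algebra_simps)
    also have "15 / ((2 * real n + 4) * (2 * real n + 6)) -
        (2 * real n + 1) / (2 * real n + 4) * (15 / ((2 * real n + 6) * (2 * real n + 8))) =
        105 / ((2 * real n + 4) * (2 * real n + 6) * (2 * real n + 8))"
      using nz[of n] by (simp add: divide_simps)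
    finally show ?thesis .
  qed
  show "bdiff (returns 1) n = returns 1 n * (3 / (2 * real n + 4))"
    "bdiff (bdiff (returns 1)) n = returns 1 n * (15 / ((2 * real n + 4) * (2 * real n + 6)))"
    "bdiff (bdiff (bdiff (returns 1))) n =
      returns 1 n * (105 / ((2 * real n + 4) * (2 * real n + 6) * (2 * real n + 8)))"
    by (fact 1 2 3)+
qed

lemma returns_1_limit: "(\<lambda>n. real n powr (3 / 2) * returns 1 n) \<longlonglongrightarrow> 1 / sqrt pi"
proof -
  \<comment> \<open>The denominators n + 1/2 and n + 1 are the extra last factors of the Pochhammer
    symbol in \<open>Gamma_series\<close> and of \<open>fact (Suc n)\<close>.\<close>
  have "(\<lambda>n. (real n)\<^sup>2 / ((real n + 1 / 2) * (real n + 1)) / Gamma_series (1 / 2) n) \<longlonglongrightarrow> 1 / Gamma (1 / 2 :: real)"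
    by (intro tendsto_divide Gamma_series_LIMSEQ) (real_asymp, simp add: Gamma_one_half_real)
  moreover have "eventually (\<lambda>n. (real n)\<^sup>2 / ((real n + 1 / 2) * (real n + 1)) / Gamma_series (1 / 2) n =
      real n powr (3 / 2) * returns 1 n) sequentially"
    using eventually_gt_at_top[of 0]
  proof eventually_elim
    case (elim n)
    have "exp ((1 / 2) * ln (real n)) = real n powr (1 / 2)" using elim by (simp add: powr_def)
    moreover have "(real n)\<^sup>2 = real n powr (3 / 2) * real n powr (1 / 2)"
      using elim by (simp flip: powr_add)
    moreover have "pochhammer (1 / 2 :: real) n > 0" by (intro pochhammer_pos) simp
    moreover have "real n + 1 / 2 \<noteq> 0" "real n + 1 \<noteq> 0" "real n powr (1 / 2) \<noteq> 0" using elim by auto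
    ultimately show ?case
      unfolding returns_1_pochhammer Gamma_series_def
      by (simp add: pochhammer_Suc divide_simps) (simp add: algebra_simps)
  qed
  ultimately show ?thesis by (simp add: Gamma_one_half_real tendsto_cong)
qed

lemma powr_mult_shift:
  assumes "(\<lambda>n. real n powr p * f n) \<longlonglongrightarrow> L" "(\<lambda>n. real n powr e * g n) \<longlonglongrightarrow> K"
    and "\<And>n. n > 0 \<Longrightarrow> h n = f n * g n"
  shows "(\<lambda>n. real n powr (p + e) * h n) \<longlonglongrightarrow> L * K"
proof (rule Lim_transform_eventually[OF tendsto_mult[OF assms(1,2)]])
  show "eventually (\<lambda>n. real n powr p * f n * (real n powr e * g n) = real n powr (p + e) * h n) sequentially"
    using eventually_gt_at_top[of 0] by eventually_elim (simp add: assms(3) powr_add)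
qed

text \<open>The third difference is scaled like the second: it has order n^(-9/2), and only its
  being negligible at that scale matters.\<close>

lemma bdiff_returns_1_limits:
  "(\<lambda>n. real n powr (5 / 2) * bdiff (returns 1) n) \<longlonglongrightarrow> 3 / 2 / sqrt pi"
  "(\<lambda>n. real n powr (7 / 2) * bdiff (bdiff (returns 1)) n) \<longlonglongrightarrow> 15 / 4 / sqrt pi"
  "(\<lambda>n. real n powr (7 / 2) * bdiff (bdiff (bdiff (returns 1))) n) \<longlonglongrightarrow> 0"
proof -
  have "(\<lambda>n. real n powr 1 * (3 / (2 * real n + 4))) \<longlonglongrightarrow> 3 / 2"
    "(\<lambda>n. real n powr 2 * (15 / ((2 * real n + 4) * (2 * real n + 6)))) \<longlonglongrightarrow> 15 / 4"
    "(\<lambda>n. real n powr 2 * (105 / ((2 * real n + 4) * (2 * real n + 6) * (2 * real n + 8)))) \<longlonglongrightarrow> 0"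
    by real_asymp+
  note * = this[THEN powr_mult_shift[OF returns_1_limit]]
  show "(\<lambda>n. real n powr (5 / 2) * bdiff (returns 1) n) \<longlonglongrightarrow> 3 / 2 / sqrt pi"
    using *(1)[OF bdiff_returns_1(1)] by (simp add: mult.commute)
  show "(\<lambda>n. real n powr (7 / 2) * bdiff (bdiff (returns 1)) n) \<longlonglongrightarrow> 15 / 4 / sqrt pi"
    using *(2)[OF bdiff_returns_1(2)] by (simp add: mult.commute)
  show "(\<lambda>n. real n powr (7 / 2) * bdiff (bdiff (bdiff (returns 1))) n) \<longlonglongrightarrow> 0"
    using *(3)[OF bdiff_returns_1(3)] by simp
qed

section \<open>Leading order of the return weights for general z\<close>

lemma powr_mult_lower:
  assumes "(\<lambda>n. real n powr (p + 1) * f n) \<longlonglongrightarrow> L"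
  shows "(\<lambda>n. real n powr p * f n) \<longlonglongrightarrow> 0"
proof -
  have "(\<lambda>n. real n powr (-1)) \<longlonglongrightarrow> 0" by real_asymp
  from tendsto_mult[OF assms this] have "(\<lambda>n. real n powr (p + 1) * f n * real n powr (-1)) \<longlonglongrightarrow> 0" by simp
  moreover have "eventually (\<lambda>n. real n powr (p + 1) * f n * real n powr (-1) = real n powr p * f n) sequentially"
    using eventually_gt_at_top[of 0]
    by eventually_elim (simp add: powr_add powr_minus)
  ultimately show ?thesis by (simp add: tendsto_cong)
qed

text \<open>In the recurrence and its differences, the term with the next difference is of smaller
  order. Hence each limit follows from the Catalan one, working downwards from the second difference
  to \<open>returns z\<close> itself.\<close>

lemma returns_limits:
  fixes z :: real
  assumes z: "0 < z" "z < 2"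
  defines "A \<equiv> z / ((2 - z)\<^sup>2 * sqrt pi)"
  shows "(\<lambda>n. real n powr (3 / 2) * returns z n) \<longlonglongrightarrow> A"
    and "(\<lambda>n. real n powr (5 / 2) * bdiff (returns z) n) \<longlonglongrightarrow> 3 / 2 * A"
    and "(\<lambda>n. real n powr (7 / 2) * bdiff (bdiff (returns z)) n) \<longlonglongrightarrow> 15 / 4 * A"
proof -
  let ?s = "(2 - z)\<^sup>2"
  have s: "?s > 0" using z by simp
  note rec0 = returns_recurrence[of z]
  note rec1 = bdiff_mult_add[OF rec0]
  note rec2 = bdiff_mult_add[OF rec1]
  note rec3 = bdiff_mult_add[OF rec2]
  have step: "(\<lambda>n. real n powr p * f n) \<longlonglongrightarrow> L * A"
    if rec: "\<And>n. ?s * f n = z * g n + 4 * (1 - z) * h n"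
      and g: "(\<lambda>n. real n powr p * g n) \<longlonglongrightarrow> L / sqrt pi" and h: "(\<lambda>n. real n powr p * h n) \<longlonglongrightarrow> 0"
    for f g h :: "nat \<Rightarrow> real" and p L
  proof -
    have f: "f n = (z * g n + 4 * (1 - z) * h n) / ?s" for n
      using rec[of n] s by (metis nonzero_mult_div_cancel_left less_irrefl)
    have "(\<lambda>n. (z * (real n powr p * g n) + 4 * (1 - z) * (real n powr p * h n)) / ?s)
        \<longlonglongrightarrow> (z * (L / sqrt pi) + 4 * (1 - z) * 0) / ?s"
      using s by (intro tendsto_intros g h) auto
    moreover have "(z * (L / sqrt pi) + 4 * (1 - z) * 0) / ?s = L * A"
      by (simp add: A_def mult.commute)
    ultimately show ?thesis unfolding f by (simp add: algebra_simps)
  qed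
  \<comment> \<open>Here only 0 \<le> y \<le> x is known for the fourth difference y and the third
    difference x. If z \<le> 1, replacing y by x changes the coefficient to (2 - z)^2 - 4 (1 - z) =
    z^2; if z > 1, the term with y is nonpositive and is dropped. The sum of the two constants
    serves both cases.\<close>
  have bound: "bdiff (bdiff (bdiff (returns z))) n \<le> (z / z\<^sup>2 + z / ?s) * bdiff (bdiff (bdiff (returns 1))) n" for n
  proof -
    let ?x = "bdiff (bdiff (bdiff (returns z))) n" and ?y = "bdiff (bdiff (bdiff (bdiff (returns z)))) n"
      and ?c = "bdiff (bdiff (bdiff (returns 1))) n"
    have y: "0 \<le> ?y" "?y \<le> ?x"
      using bdiff4_returns_nonneg bdiff3_returns_nonneg z by (auto intro: bdiff_le)
    have c: "0 \<le> ?c" unfolding bdiff_returns_1 by (simp add: returns_nonneg)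
    have r: "?s * ?x = z * ?c + 4 * (1 - z) * ?y" by (rule rec3)
    have "?x \<le> z / z\<^sup>2 * ?c \<or> ?x \<le> z / ?s * ?c"
    proof (cases "z \<le> 1")
      case True
      then have "(1 - z) * ?y \<le> (1 - z) * ?x" using y by (intro mult_left_mono) auto
      then have "z\<^sup>2 * ?x \<le> z * ?c" using r by (simp add: power2_eq_square algebra_simps)
      then show ?thesis using z by (simp add: field_simps)
    next
      case False
      then have "4 * (1 - z) * ?y \<le> 0" using y(1) by (intro mult_nonpos_nonneg[of "4 * (1 - z)"]) auto
      then have "?s * ?x \<le> z * ?c" using r by linarith
      then show ?thesis using s by (simp add: field_simps)
    qed
    moreover have "0 \<le> z / z\<^sup>2 * ?c" "0 \<le> z / ?s * ?c" using c z s by auto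
    ultimately show ?thesis unfolding distrib_right by linarith
  qed
  have 3: "(\<lambda>n. real n powr (7 / 2) * bdiff (bdiff (bdiff (returns z))) n) \<longlonglongrightarrow> 0"
  proof (rule tendsto_sandwich[where f = "\<lambda>_. 0"])
    show "(\<lambda>n. (z / z\<^sup>2 + z / ?s) * (real n powr (7 / 2) * bdiff (bdiff (bdiff (returns 1))) n)) \<longlonglongrightarrow> 0"
      using tendsto_mult_right_zero[OF bdiff_returns_1_limits(3)] .
    show "eventually (\<lambda>n. real n powr (7 / 2) * bdiff (bdiff (bdiff (returns z))) n \<le>
        (z / z\<^sup>2 + z / ?s) * (real n powr (7 / 2) * bdiff (bdiff (bdiff (returns 1))) n)) sequentially"
    proof (intro always_eventually allI)
      fix n
      show "real n powr (7 / 2) * bdiff (bdiff (bdiff (returns z))) n \<le>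
        (z / z\<^sup>2 + z / ?s) * (real n powr (7 / 2) * bdiff (bdiff (bdiff (returns 1))) n)"
        using mult_left_mono[OF bound[of n], of "real n powr (7 / 2)"] by (simp add: mult.left_commute)
    qed
  qed (use bdiff3_returns_nonneg[OF z] in auto)
  show 2: "(\<lambda>n. real n powr (7 / 2) * bdiff (bdiff (returns z)) n) \<longlonglongrightarrow> 15 / 4 * A"
    by (rule step[OF rec2 bdiff_returns_1_limits(2) 3])
  then have "(\<lambda>n. real n powr (5 / 2 + 1) * bdiff (bdiff (returns z)) n) \<longlonglongrightarrow> 15 / 4 * A"
    by simp
  from step[OF rec1 bdiff_returns_1_limits(1) powr_mult_lower[OF this]]
  show 1: "(\<lambda>n. real n powr (5 / 2) * bdiff (returns z) n) \<longlonglongrightarrow> 3 / 2 * A" .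
  then have "(\<lambda>n. real n powr (3 / 2 + 1) * bdiff (returns z) n) \<longlonglongrightarrow> 3 / 2 * A"
    by simp
  from step[OF rec0 returns_1_limit powr_mult_lower[OF this]]
  show "(\<lambda>n. real n powr (3 / 2) * returns z n) \<longlonglongrightarrow> A" by simp
qed

subsection \<open>The pressure\<close>

text \<open>Since \<open>q n\<close> tends to infinity, the limit applies along it, and n^p = (q n /
  n)^(-p) (q n)^p converts the scale.\<close>

lemma powr_mult_subsequence:
  assumes lim: "(\<lambda>n. real n powr p * f n) \<longlonglongrightarrow> L"
    and q: "(\<lambda>n. real (q n) / real n) \<longlonglongrightarrow> a" and "0 < a"
  shows "(\<lambda>n. real n powr p * f (q n)) \<longlonglongrightarrow> a powr (- p) * L"
proof -
  have pos: "eventually (\<lambda>n. real (q n) / real n > 0) sequentially"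
    using order_tendstoD(1)[OF q \<open>0 < a\<close>] .
  have "filterlim (\<lambda>n. real (q n) / real n * real n) at_top sequentially"
    by (rule filterlim_tendsto_pos_mult_at_top[OF q \<open>0 < a\<close> filterlim_real_sequentially])
  moreover have "eventually (\<lambda>n. real (q n) / real n * real n = real (q n)) sequentially"
    using eventually_gt_at_top[of 0] by eventually_elim simp
  ultimately have "filterlim (\<lambda>n. real (q n)) at_top sequentially"
    by (simp cong: filterlim_cong)
  then have "filterlim q at_top sequentially"
    by (simp add: filterlim_sequentially_iff_filterlim_real)
  then have "(\<lambda>n. real (q n) powr p * f (q n)) \<longlonglongrightarrow> L"
    using filterlim_compose[OF lim] by blast
  moreover have "(\<lambda>n. (real (q n) / real n) powr (- p)) \<longlonglongrightarrow> a powr (- p)"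
    using \<open>0 < a\<close> by (intro tendsto_intros q) auto
  ultimately have "(\<lambda>n. (real (q n) / real n) powr (- p) * (real (q n) powr p * f (q n))) \<longlonglongrightarrow> a powr (- p) * L"
    by (rule tendsto_mult[rotated])
  then show ?thesis
  proof (rule Lim_transform_eventually)
    show "eventually (\<lambda>n. (real (q n) / real n) powr (- p) * (real (q n) powr p * f (q n)) =
        real n powr p * f (q n)) sequentially"
      using pos eventually_gt_at_top[of 0]
    proof eventually_elim
      case (elim n)
      then have "real (q n) > 0" by (simp add: zero_less_divide_iff)
      then show ?case using elim by (simp add: powr_divide powr_minus field_simps)
    qed
  qed
qed

text \<open>Each product in the numerator has order n^(-13/2) and each in the denominator has order
  n^(-5). The factor 5/2 is (15/4) / (15/4 - (3/2)^2).\<close>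

lemma Zstar_div_C_limit:
  fixes z a :: real and q :: "nat \<Rightarrow> nat"
  assumes z: "0 < z" "z < 2" and a: "0 < a" "a < 1"
    and q: "(\<lambda>n. real (q n) / real n) \<longlonglongrightarrow> a"
  shows "(\<lambda>n. real n powr (3 / 2) * (Zstar n z (q n) / C n z 0)) \<longlonglongrightarrow>
    5 / 2 * (z / ((2 - z)\<^sup>2 * sqrt pi)) * (a * (1 - a)) powr (- (3 / 2))"
proof -
  define A where "A = z / ((2 - z)\<^sup>2 * sqrt pi)"
  have A: "A > 0" using z by (simp add: A_def)
  define r where "r n = n - q n" for n
  let ?m = "returns z" and ?d = "bdiff (returns z)" and ?e = "bdiff (bdiff (returns z))"
  have q_bounds: "eventually (\<lambda>n. 0 < q n \<and> q n < n) sequentially"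
    using order_tendstoD(1)[OF q a(1)] order_tendstoD(2)[OF q a(2)] eventually_gt_at_top[of 0]
    by eventually_elim (simp add: zero_less_divide_iff divide_less_eq)
  have "(\<lambda>n. 1 - real (q n) / real n) \<longlonglongrightarrow> 1 - a" by (intro tendsto_intros q)
  moreover have "eventually (\<lambda>n. 1 - real (q n) / real n = real (r n) / real n) sequentially"
    using q_bounds by eventually_elim (simp add: r_def of_nat_diff field_simps)
  ultimately have r: "(\<lambda>n. real (r n) / real n) \<longlonglongrightarrow> 1 - a"
    by (rule Lim_transform_eventually)
  have a': "0 < 1 - a" using a by simp
  note lim = returns_limits[OF z, folded A_def]
  note lim_q = lim(1,2)[THEN powr_mult_subsequence, OF q a(1)]
  note lim_r = lim(1,2)[THEN powr_mult_subsequence, OF r a']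
  define num where "num n = ?m (q n) * ?m (r n) * ?e n - ?d n * (?m (q n) * ?d (r n) + ?d (q n) * ?m (r n))
    + ?d (q n) * ?d (r n) * ?m n" for n
  define den where "den n = ?m n * ?e n - (?d n)\<^sup>2" for n
  define B where "B = A ^ 3 * (a * (1 - a)) powr (- (3 / 2)) * (15 / 4)"
  have num_lim: "(\<lambda>n. real n powr (13 / 2) * num n) \<longlonglongrightarrow> B"
  proof -
    let ?a = "\<lambda>p. a powr (- p)" and ?b = "\<lambda>p. (1 - a) powr (- p)"
    have "(\<lambda>n. (real n powr (3 / 2) * ?m (q n)) * (real n powr (3 / 2) * ?m (r n)) * (real n powr (7 / 2) * ?e n)
        - (real n powr (5 / 2) * ?d n) * ((real n powr (3 / 2) * ?m (q n)) * (real n powr (5 / 2) * ?d (r n))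
            + (real n powr (5 / 2) * ?d (q n)) * (real n powr (3 / 2) * ?m (r n)))
        + (real n powr (5 / 2) * ?d (q n)) * (real n powr (5 / 2) * ?d (r n)) * (real n powr (3 / 2) * ?m n))
      \<longlonglongrightarrow> (?a (3 / 2) * A) * (?b (3 / 2) * A) * (15 / 4 * A)
        - (3 / 2 * A) * ((?a (3 / 2) * A) * (?b (5 / 2) * (3 / 2 * A)) + (?a (5 / 2) * (3 / 2 * A)) * (?b (3 / 2) * A))
        + (?a (5 / 2) * (3 / 2 * A)) * (?b (5 / 2) * (3 / 2 * A)) * A" (is "_ \<longlonglongrightarrow> ?L")
      by (intro tendsto_add tendsto_diff tendsto_mult lim lim_q lim_r)
    moreover have "?L = B"
    proof -
      have pow: "x powr (- (5 / 2)) = x powr (- (3 / 2)) * inverse x" if "x > 0" for x :: real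
        using that powr_add[of x "- (3 / 2)" "-1"] by (simp add: powr_minus)
      \<comment> \<open>Beyond the product with the second difference, all contributions are
        multiples of 1/(a(1-a)) - 1/a - 1/(1-a), which is zero.\<close>
      have "?L = B + 9 / 4 * A ^ 3 * (a powr (- (3 / 2)) * (1 - a) powr (- (3 / 2))) *
          (inverse a * inverse (1 - a) - inverse a - inverse (1 - a))"
        unfolding B_def powr_mult pow[OF a(1)] pow[OF a'] by (simp add: power3_eq_cube algebra_simps add_divide_distrib diff_divide_distrib)
      also have "inverse a * inverse (1 - a) - inverse a - inverse (1 - a) = 0"
        using a by (simp add: field_simps)
      finally show ?thesis by simp
    qed
    moreover have "eventually (\<lambda>n. (real n powr (3 / 2) * ?m (q n)) * (real n powr (3 / 2) * ?m (r n)) * (real n powr (7 / 2) * ?e n)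
        - (real n powr (5 / 2) * ?d n) * ((real n powr (3 / 2) * ?m (q n)) * (real n powr (5 / 2) * ?d (r n))
            + (real n powr (5 / 2) * ?d (q n)) * (real n powr (3 / 2) * ?m (r n)))
        + (real n powr (5 / 2) * ?d (q n)) * (real n powr (5 / 2) * ?d (r n)) * (real n powr (3 / 2) * ?m n)
        = real n powr (13 / 2) * num n) sequentially"
      using eventually_gt_at_top[of 0]
    proof eventually_elim
      case (elim n)
      have pow: "real n powr (5 / 2) = real n powr (3 / 2) * real n"
        "real n powr (7 / 2) = real n powr (3 / 2) * (real n * real n)"
        "real n powr (13 / 2) = real n powr (3 / 2) * real n powr (3 / 2) * real n powr (3 / 2) * (real n * real n)"
        using elim powr_add[of "real n" "3 / 2" 1] powr_add[of "real n" "3 / 2" 2]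
          powr_add[of "real n" "9 / 2" 2] powr_add[of "real n" 3 "3 / 2"] powr_add[of "real n" "3 / 2" "3 / 2"]
        by (simp_all add: power2_eq_square)
      show ?case unfolding num_def pow by (simp only: algebra_simps)
    qed
    ultimately show ?thesis by (simp only: Lim_transform_eventually)
  qed
  have den_lim: "(\<lambda>n. real n powr 5 * den n) \<longlonglongrightarrow> 3 / 2 * A\<^sup>2"
  proof -
    have "(\<lambda>n. (real n powr (3 / 2) * ?m n) * (real n powr (7 / 2) * ?e n) - (real n powr (5 / 2) * ?d n)\<^sup>2)
      \<longlonglongrightarrow> A * (15 / 4 * A) - (3 / 2 * A)\<^sup>2"
      by (intro tendsto_diff tendsto_mult tendsto_power lim)
    moreover have "A * (15 / 4 * A) - (3 / 2 * A)\<^sup>2 = 3 / 2 * A\<^sup>2" by (simp add: power2_eq_square)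
    moreover have "(real n powr (3 / 2) * ?m n) * (real n powr (7 / 2) * ?e n) - (real n powr (5 / 2) * ?d n)\<^sup>2
        = real n powr 5 * den n" for n
    proof -
      have pow: "real n powr 5 = real n powr (3 / 2) * real n powr (7 / 2)"
        "(real n powr (5 / 2))\<^sup>2 = real n powr (3 / 2) * real n powr (7 / 2)"
        by (simp_all add: power2_eq_square flip: powr_add)
      show ?thesis unfolding den_def power_mult_distrib pow by (simp only: algebra_simps)
    qed
    ultimately show ?thesis by (simp only:)
  qed
  have "(\<lambda>n. (real n powr (13 / 2) * num n) / (real n powr 5 * den n)) \<longlonglongrightarrow> B / (3 / 2 * A\<^sup>2)"
    using A by (intro tendsto_divide num_lim den_lim) auto
  moreover have "B / (3 / 2 * A\<^sup>2) = 5 / 2 * A * (a * (1 - a)) powr (- (3 / 2))"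
    using A by (simp add: B_def field_simps power2_eq_square power3_eq_cube)
  moreover have "eventually (\<lambda>n. (real n powr (13 / 2) * num n) / (real n powr 5 * den n) =
      real n powr (3 / 2) * (Zstar n z (q n) / C n z 0)) sequentially"
    using q_bounds
  proof eventually_elim
    case (elim n)
    \<comment> \<open>Expanding the fraction by \<open>z\<close> brings both parts into polynomial
      form, where the common power of 4 cancels.\<close>
    have "Zstar n z (q n) / C n z 0 = (z * Zstar n z (q n)) / (z * C n z 0)"
      using z by simp
    also have "\<dots> = num n / den n"
      unfolding C_0_eq_returns using elim z Zstar_eq_returns[of "q n" n z]
      by (simp add: num_def den_def r_def)
    finally have "Zstar n z (q n) / C n z 0 = num n / den n" .
    moreover have "real n powr (13 / 2) = real n powr (3 / 2) * real n powr 5"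
      by (simp only: powr_add[symmetric]) simp
    moreover have "real n powr 5 \<noteq> 0" using elim by simp
    ultimately show ?case by simp
  qed
  ultimately show ?thesis
    unfolding A_def[symmetric] by (simp only: Lim_transform_eventually)
qed

theorem mainTheorem7:
  fixes a z :: real
  assumes "0 < a" and "a < 1" and "0 < z" and "z < 2"
  shows "(\<lambda>n::nat. pressure n z (2 * nat \<lfloor>a * real n / 2\<rfloor>)) \<sim>[at_top]
         (\<lambda>n. - (5 * z / (2 * real n powr (3 / 2) * (2 - z)\<^sup>2 * sqrt (pi * a ^ 3 * (1 - a) ^ 3))))"
proof -
  define q where "q n = 2 * nat \<lfloor>a * real n / 2\<rfloor>" for n
  define x where "x n = Zstar n z (q n) / C n z 0" for n
  define K where "K = 5 / 2 * (z / ((2 - z)\<^sup>2 * sqrt pi)) * (a * (1 - a)) powr (- (3 / 2))"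
  have K: "K > 0" using assms by (simp add: K_def)
  have q: "(\<lambda>n. real (q n) / real n) \<longlonglongrightarrow> a"
  proof -
    have "(\<lambda>n. 2 * of_int \<lfloor>a * real n / 2\<rfloor> / real n) \<longlonglongrightarrow> a" using assms(1) by real_asymp
    moreover have "real (q n) = 2 * of_int \<lfloor>a * real n / 2\<rfloor>" for n
      using assms(1) by (simp add: q_def)
    ultimately show ?thesis by simp
  qed
  have lim: "(\<lambda>n. real n powr (3 / 2) * x n) \<longlonglongrightarrow> K"
    unfolding x_def K_def by (rule Zstar_div_C_limit[OF assms(3,4,1,2) q])
  have "(\<lambda>n. real n powr - (3 / 2)) \<longlonglongrightarrow> 0" by real_asymp
  from tendsto_mult[OF this lim] have "(\<lambda>n. real n powr - (3 / 2) * (real n powr (3 / 2) * x n)) \<longlonglongrightarrow> 0" by simp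
  moreover have "eventually (\<lambda>n. real n powr - (3 / 2) * (real n powr (3 / 2) * x n) = x n) sequentially"
    using eventually_gt_at_top[of 0] by eventually_elim (simp add: powr_minus)
  ultimately have "x \<longlonglongrightarrow> 0" by (rule Lim_transform_eventually)
  \<comment> \<open>The positive limit \<open>K\<close> keeps \<open>x n\<close> away from 0 for
    large \<open>n\<close>, so that the limit of ln (1 - x) / x in the punctured neighbourhood of 0
    can be composed with \<open>x\<close>.\<close>
  moreover have nz: "eventually (\<lambda>n. x n \<noteq> 0) sequentially"
    using order_tendstoD(1)[OF lim K] by eventually_elim auto
  ultimately have "filterlim x (at 0) sequentially" by (simp add: filterlim_at)
  moreover have "((\<lambda>x::real. ln (1 - x) / x) \<longlongrightarrow> -1) (at 0)" by real_asymp
  ultimately have "(\<lambda>n. ln (1 - x n) / x n) \<longlonglongrightarrow> -1" by (rule filterlim_compose[rotated])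
  from tendsto_mult[OF this lim]
  have "(\<lambda>n. ln (1 - x n) / x n * (real n powr (3 / 2) * x n) / (- K)) \<longlonglongrightarrow> (-1) * K / (- K)"
    using K by (intro tendsto_divide tendsto_const) auto
  then have "(\<lambda>n. ln (1 - x n) / x n * (real n powr (3 / 2) * x n) / (- K)) \<longlonglongrightarrow> 1"
    using K by simp
  then have "(\<lambda>n. pressure n z (q n) / (- (K / real n powr (3 / 2)))) \<longlonglongrightarrow> 1"
  proof (rule Lim_transform_eventually)
    show "eventually (\<lambda>n. ln (1 - x n) / x n * (real n powr (3 / 2) * x n) / (- K) =
        pressure n z (q n) / (- (K / real n powr (3 / 2)))) sequentially"
      using nz by eventually_elim (simp add: pressure_def x_def[symmetric])
  qed
  then have "(\<lambda>n. pressure n z (q n)) \<sim>[at_top] (\<lambda>n. - (K / real n powr (3 / 2)))"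
    by (rule asymp_equivI')
  also have "(\<lambda>n. - (K / real n powr (3 / 2))) =
      (\<lambda>n. - (5 * z / (2 * real n powr (3 / 2) * (2 - z)\<^sup>2 * sqrt (pi * a ^ 3 * (1 - a) ^ 3))))"
  proof -
    \<comment> \<open>Absorbs the real power in \<open>K\<close> into the square root of the stated
      form.\<close>
    have "(a * (1 - a)) powr (3 / 2) = sqrt ((a * (1 - a)) ^ 3)"
      using assms by (simp add: powr_half_sqrt[symmetric] powr_powr flip: powr_numeral)
    then have "sqrt (pi * a ^ 3 * (1 - a) ^ 3) = sqrt pi * (a * (1 - a)) powr (3 / 2)"
      by (simp add: real_sqrt_mult power_mult_distrib)
    then have "K = 5 * z / (2 * (2 - z)\<^sup>2 * sqrt (pi * a ^ 3 * (1 - a) ^ 3))"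
      unfolding K_def by (simp add: powr_minus field_simps)
    then show ?thesis by (simp add: field_simps)
  qed
  finally show ?thesis unfolding q_def .
qed

end
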